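(* Let $G$ be a non-trivial countable amenable discrete group. Then there always exist some product sequence $(u_i)_{i\in\mathbb{N}}$ in $Z^2(G,\mathbb{T})$ satisfying $u_i\neq1$ for all $i$ and some sequence $\phi=(\phi_i)$ of unit vectors in $\ell^2(G)$ such that $\otimes_i\lambda_{u_i}$ exists on $\mathcal{H}^\phi=\bigotimes_i^{\phi}\ell^2(G)$. If $H^2(G,\mathbb{T})$ is non-trivial and $u\in Z^2(G,\mathbb{T})$ is such that $1\neq[u]\in H^2(G,\mathbb{T})$, then the sequence $(u_i)$ may be chosen so that, in addition, $u=\prod_iu_i$.
   Context: $Z^2(G,\mathbb{T})$ is the group (pointwise product) of normalized 2-cocycles, i.e. maps $u:G\times G\to\mathbb{T}$ (circle group) with $u(x,y)u(xy,z)=u(y,z)u(x,yz)$ and $u(x,e)=u(e,x)=1$. $B^2(G,\mathbb{T})$ is the subgroup of coboundaries $(\mathrm{d}\rho)(x,y)=\rho(x)\rho(y)\overline{\rho(xy)}$ with $\rho:G\to\mathbb{T}$, $\rho(e)=1$; $H^2(G,\mathbb{T})=Z^2(G,\mathbb{T})/B^2(G,\mathbb{T})$ and $[u]$ is the class of $u$. An infinite product $\prod_iz_i$ of complex numbers exists if the net of finite products $\prod_{i\in J}z_i$, indexed by the finite non-empty $J\subset\mathbb{N}$ ordered by inclusion, converges. A sequence $(u_i)$ in $Z^2(G,\mathbb{T})$ is a product sequence if the pointwise infinite product $\prod_iu_i$ exists on $G\times G$. For $u\in Z^2(G,\mathbb{T})$, the left $u$-regular projective unitary representation $\lambda_u$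 on $\ell^2(G)$ is $(\lambda_u(x)f)(y)=u(y^{-1},x)f(x^{-1}y)$. Infinite tensor products: for Hilbert spaces $\mathcal{H}_i$ and unit vectors $\phi_i\in\mathcal{H}_i$, $\phi=(\phi_i)$, the space $\mathcal{H}^\phi=\bigotimes_i^{\phi}\mathcal{H}_i$ is the completed inductive limit of the spaces $\mathcal{H}_1\otimes\cdots\otimes\mathcal{H}_n$ under the isometries $\psi\mapsto\psi\otimes\phi_{n+1}$. For bounded operators $T_i$ on $\mathcal{H}_i$ and a finite non-empty $J\subset\mathbb{N}$, let $\tilde T_J$ be the bounded operator on $\mathcal{H}^\phi$ acting as $T_i$ in the factors $i\in J$ and as the identity in the others. One says that $\otimes_iT_i$ exists on $\mathcal{H}^\phi$ if the net $(\tilde T_J)_J$ (indexed by finite non-empty subsets of $\mathbb{N}$ ordered by inclusion) converges in the strong operator topology to a bounded operator, which is then denoted $\otimes_iT_i$. "$\otimes_i\lambda_{u_i}$ exists" means $\otimes_i\lambda_{u_i}(x)$ exists for every $x\in G$. *)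

theory Defs
  imports "HOL-Analysis.Analysis" "HOL-Algebra.Coset"
begin

section \<open>Amenable groups\<close>

text \<open>Only the values on the carrier matter: additivity and positivity, which is imposed on the
  carrier only, force a mean to agree on bounded functions that agree on the carrier.\<close>

definition invariant_mean :: "('a, 'b) monoid_scheme \<Rightarrow> (('a \<Rightarrow> real) \<Rightarrow> real) \<Rightarrow> bool" where
  "invariant_mean G m \<longleftrightarrow>
     (\<forall>f g. bounded (f ` carrier G) \<longrightarrow> bounded (g ` carrier G) \<longrightarrow> m (\<lambda>x. f x + g x) = m f + m g) \<and>
     (\<forall>c f. bounded (f ` carrier G) \<longrightarrow> m (\<lambda>x. c * f x) = c * m f) \<and>
     (\<forall>f. bounded (f ` carrier G) \<longrightarrow> (\<forall>x\<in>carrier G. 0 \<le> f x) \<longrightarrow> 0 \<le> m f) \<and>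
     m (\<lambda>x. 1) = 1 \<and>
     (\<forall>a\<in>carrier G. \<forall>f. bounded (f ` carrier G) \<longrightarrow> m (\<lambda>x. f (inv\<^bsub>G\<^esub> a \<otimes>\<^bsub>G\<^esub> x)) = m f)"

definition amenable :: "('a, 'b) monoid_scheme \<Rightarrow> bool" where
  "amenable G \<longleftrightarrow> (\<exists>m. invariant_mean G m)"


section \<open>Second cohomology with values in the circle group\<close>

text \<open>Cocycles are extensional functions on pairs, so that the trivial cocycle is unique.\<close>

definition cocycles :: "('a, 'b) monoid_scheme \<Rightarrow> ('a \<times> 'a \<Rightarrow> complex) set" where
  "cocycles G = {u \<in> carrier G \<times> carrier G \<rightarrow>\<^sub>E sphere 0 1.
     (\<forall>x\<in>carrier G. \<forall>y\<in>carrier G. \<forall>z\<in>carrier G.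
        u (x, y) * u (x \<otimes>\<^bsub>G\<^esub> y, z) = u (y, z) * u (x, y \<otimes>\<^bsub>G\<^esub> z)) \<and>
     (\<forall>x\<in>carrier G. u (x, \<one>\<^bsub>G\<^esub>) = 1 \<and> u (\<one>\<^bsub>G\<^esub>, x) = 1)}"

definition Z2 :: "('a, 'b) monoid_scheme \<Rightarrow> ('a \<times> 'a \<Rightarrow> complex) monoid" where
  "Z2 G = \<lparr>carrier = cocycles G,
           mult = (\<lambda>u v. \<lambda>p\<in>carrier G \<times> carrier G. u p * v p),
           one = (\<lambda>p\<in>carrier G \<times> carrier G. 1)\<rparr>"

definition coboundary :: "('a, 'b) monoid_scheme \<Rightarrow> ('a \<Rightarrow> complex) \<Rightarrow> 'a \<times> 'a \<Rightarrow> complex" where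
  "coboundary G \<rho> = (\<lambda>(x, y)\<in>carrier G \<times> carrier G. \<rho> x * \<rho> y * cnj (\<rho> (x \<otimes>\<^bsub>G\<^esub> y)))"

definition B2 :: "('a, 'b) monoid_scheme \<Rightarrow> ('a \<times> 'a \<Rightarrow> complex) set" where
  "B2 G = {coboundary G \<rho> | \<rho>. \<rho> \<in> carrier G \<rightarrow> sphere 0 1 \<and> \<rho> \<one>\<^bsub>G\<^esub> = 1}"

definition H2 :: "('a, 'b) monoid_scheme \<Rightarrow> ('a \<times> 'a \<Rightarrow> complex) set monoid" where
  "H2 G = Z2 G Mod B2 G"

definition cohomology_class ::
    "('a, 'b) monoid_scheme \<Rightarrow> ('a \<times> 'a \<Rightarrow> complex) \<Rightarrow> ('a \<times> 'a \<Rightarrow> complex) set" where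
  "cohomology_class G u = B2 G #>\<^bsub>Z2 G\<^esub> u"

lemma comm_group_Z2:
  assumes "group G" shows "comm_group (Z2 G)"
proof -
  interpret group G by fact
  show ?thesis
  proof (rule comm_groupI)
    show "\<one>\<^bsub>Z2 G\<^esub> \<in> carrier (Z2 G)"
      by (auto simp: Z2_def cocycles_def)
  next
    fix u v assume uv: "u \<in> carrier (Z2 G)" "v \<in> carrier (Z2 G)"
    then have u: "u \<in> cocycles G" and v: "v \<in> cocycles G" by (auto simp: Z2_def)
    have n: "cmod (u (x, y)) = 1" "cmod (v (x, y)) = 1" if "x \<in> carrier G" "y \<in> carrier G" for x y
      using u v that PiE_mem[of u "carrier G \<times> carrier G" "\<lambda>_. sphere 0 1" "(x, y)"]
        PiE_mem[of v "carrier G \<times> carrier G" "\<lambda>_. sphere 0 1" "(x, y)"]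
      by (auto simp: cocycles_def)
    have c: "u (x, y) * v (x, y) * (u (x \<otimes>\<^bsub>G\<^esub> y, z) * v (x \<otimes>\<^bsub>G\<^esub> y, z)) =
        u (y, z) * v (y, z) * (u (x, y \<otimes>\<^bsub>G\<^esub> z) * v (x, y \<otimes>\<^bsub>G\<^esub> z))"
      if "x \<in> carrier G" "y \<in> carrier G" "z \<in> carrier G" for x y z
    proof -
      have "u (x, y) * u (x \<otimes>\<^bsub>G\<^esub> y, z) = u (y, z) * u (x, y \<otimes>\<^bsub>G\<^esub> z)"
        "v (x, y) * v (x \<otimes>\<^bsub>G\<^esub> y, z) = v (y, z) * v (x, y \<otimes>\<^bsub>G\<^esub> z)"
        using u v that by (auto simp: cocycles_def)
      then show ?thesis by algebra
    qed
    have e: "u (x, \<one>\<^bsub>G\<^esub>) = 1" "u (\<one>\<^bsub>G\<^esub>, x) = 1" "v (x, \<one>\<^bsub>G\<^esub>) = 1" "v (\<one>\<^bsub>G\<^esub>, x) = 1"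
      if "x \<in> carrier G" for x
      using u v that by (auto simp: cocycles_def)
    show "u \<otimes>\<^bsub>Z2 G\<^esub> v \<in> carrier (Z2 G)"
      using n c e by (auto simp: Z2_def cocycles_def norm_mult)
  next
    fix u assume "u \<in> carrier (Z2 G)"
    then have u: "u \<in> cocycles G" by (auto simp: Z2_def)
    let ?v = "\<lambda>p\<in>carrier G \<times> carrier G. inverse (u p)"
    have n: "cmod (u (x, y)) = 1" if "x \<in> carrier G" "y \<in> carrier G" for x y
      using u that PiE_mem[of u "carrier G \<times> carrier G" "\<lambda>_. sphere 0 1" "(x, y)"]
      by (auto simp: cocycles_def)
    then have nz: "u (x, y) \<noteq> 0" if "x \<in> carrier G" "y \<in> carrier G" for x y
      using that by fastforce
    have c: "inverse (u (x, y)) * inverse (u (x \<otimes>\<^bsub>G\<^esub> y, z)) =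
        inverse (u (y, z)) * inverse (u (x, y \<otimes>\<^bsub>G\<^esub> z))"
      if "x \<in> carrier G" "y \<in> carrier G" "z \<in> carrier G" for x y z
    proof -
      have "u (x, y) * u (x \<otimes>\<^bsub>G\<^esub> y, z) = u (y, z) * u (x, y \<otimes>\<^bsub>G\<^esub> z)"
        using u that by (auto simp: cocycles_def)
      then show ?thesis by (metis inverse_mult_distrib)
    qed
    have e: "u (x, \<one>\<^bsub>G\<^esub>) = 1" "u (\<one>\<^bsub>G\<^esub>, x) = 1" if "x \<in> carrier G" for x
      using u that by (auto simp: cocycles_def)
    have "?v \<in> carrier (Z2 G)"
      using n c e by (auto simp: Z2_def cocycles_def norm_inverse)
    moreover have "?v \<otimes>\<^bsub>Z2 G\<^esub> u = \<one>\<^bsub>Z2 G\<^esub>"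
      using nz by (auto simp: Z2_def fun_eq_iff restrict_def)
    ultimately show "\<exists>v\<in>carrier (Z2 G). v \<otimes>\<^bsub>Z2 G\<^esub> u = \<one>\<^bsub>Z2 G\<^esub>" by blast
  next
    fix u assume "u \<in> carrier (Z2 G)"
    then show "\<one>\<^bsub>Z2 G\<^esub> \<otimes>\<^bsub>Z2 G\<^esub> u = u"
      by (auto simp: Z2_def cocycles_def fun_eq_iff restrict_def PiE_iff extensional_def)
  qed (auto simp: Z2_def fun_eq_iff restrict_def)
qed

lemma coboundary_cocycle:
  assumes "group G" "\<rho> \<in> carrier G \<rightarrow> sphere 0 1" "\<rho> \<one>\<^bsub>G\<^esub> = 1"
  shows "coboundary G \<rho> \<in> carrier (Z2 G)"
proof -
  interpret group G by fact
  have 1: "cmod (\<rho> x) = 1" "\<rho> x * cnj (\<rho> x) = 1" if "x \<in> carrier G" for x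
  proof -
    show "cmod (\<rho> x) = 1" using assms(2) that by (auto simp: Pi_iff)
    then show "\<rho> x * cnj (\<rho> x) = 1" by (metis complex_norm_square of_real_1 power_one)
  qed
  have "\<rho> x * \<rho> y * cnj (\<rho> (x \<otimes>\<^bsub>G\<^esub> y)) * (\<rho> (x \<otimes>\<^bsub>G\<^esub> y) * \<rho> z * cnj (\<rho> (x \<otimes>\<^bsub>G\<^esub> y \<otimes>\<^bsub>G\<^esub> z))) =
        \<rho> y * \<rho> z * cnj (\<rho> (y \<otimes>\<^bsub>G\<^esub> z)) * (\<rho> x * \<rho> (y \<otimes>\<^bsub>G\<^esub> z) * cnj (\<rho> (x \<otimes>\<^bsub>G\<^esub> (y \<otimes>\<^bsub>G\<^esub> z))))"
    if "x \<in> carrier G" "y \<in> carrier G" "z \<in> carrier G" for x y z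
    using 1(2)[of "x \<otimes>\<^bsub>G\<^esub> y"] 1(2)[of "y \<otimes>\<^bsub>G\<^esub> z"] that
    by (simp add: m_assoc) algebra
  then show ?thesis
    using 1 assms(3) by (auto simp: Z2_def cocycles_def coboundary_def norm_mult)
qed

lemma subgroup_B2:
  assumes "group G" shows "subgroup (B2 G) (Z2 G)"
proof -
  interpret group G by fact
  interpret Z: comm_group "Z2 G" by (rule comm_group_Z2) fact
  have nz: "\<rho> x * cnj (\<rho> x) = 1" if "\<rho> \<in> carrier G \<rightarrow> sphere 0 1" "x \<in> carrier G"
    for \<rho> :: "'a \<Rightarrow> complex" and x
  proof -
    have "cmod (\<rho> x) = 1" using that by (auto simp: Pi_iff)
    then show ?thesis by (metis complex_norm_square of_real_1 power_one)
  qed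
  show ?thesis
  proof (rule Z.subgroupI)
    show "B2 G \<subseteq> carrier (Z2 G)" using coboundary_cocycle[OF assms] by (auto simp: B2_def)
    have "coboundary G (\<lambda>_. 1) \<in> B2 G" by (auto simp: B2_def)
    then show "B2 G \<noteq> {}" by blast
  next
    fix u assume "u \<in> B2 G"
    then obtain \<rho> where r: "u = coboundary G \<rho>" "\<rho> \<in> carrier G \<rightarrow> sphere 0 1" "\<rho> \<one>\<^bsub>G\<^esub> = 1"
      by (auto simp: B2_def)
    have r': "(\<lambda>x. cnj (\<rho> x)) \<in> carrier G \<rightarrow> sphere 0 1" "cnj (\<rho> \<one>\<^bsub>G\<^esub>) = 1"
      using r by (auto simp: Pi_iff)
    let ?v = "coboundary G (\<lambda>x. cnj (\<rho> x))"
    have "?v \<otimes>\<^bsub>Z2 G\<^esub> u = \<one>\<^bsub>Z2 G\<^esub>"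
    proof
      fix p
      show "(?v \<otimes>\<^bsub>Z2 G\<^esub> u) p = \<one>\<^bsub>Z2 G\<^esub> p"
      proof (cases "p \<in> carrier G \<times> carrier G")
        case True
        then obtain x y where p: "p = (x, y)" "x \<in> carrier G" "y \<in> carrier G" by auto
        have "cnj (\<rho> x) * cnj (\<rho> y) * \<rho> (x \<otimes>\<^bsub>G\<^esub> y) * (\<rho> x * \<rho> y * cnj (\<rho> (x \<otimes>\<^bsub>G\<^esub> y))) =
          (\<rho> x * cnj (\<rho> x)) * (\<rho> y * cnj (\<rho> y)) * (\<rho> (x \<otimes>\<^bsub>G\<^esub> y) * cnj (\<rho> (x \<otimes>\<^bsub>G\<^esub> y)))"
          by (simp add: mult_ac)
        also have "\<dots> = 1" using nz[OF r(2)] p by simp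
        finally show ?thesis using p r(1) by (simp add: Z2_def coboundary_def)
      qed (simp add: Z2_def)
    qed
    then have "inv\<^bsub>Z2 G\<^esub> u = ?v"
      using coboundary_cocycle[OF assms] r r' by (intro Z.inv_equality) auto
    then show "inv\<^bsub>Z2 G\<^esub> u \<in> B2 G" using r' by (auto simp: B2_def)
  next
    fix u v assume "u \<in> B2 G" "v \<in> B2 G"
    then obtain \<rho> \<sigma> where r: "u = coboundary G \<rho>" "\<rho> \<in> carrier G \<rightarrow> sphere 0 1" "\<rho> \<one>\<^bsub>G\<^esub> = 1"
      "v = coboundary G \<sigma>" "\<sigma> \<in> carrier G \<rightarrow> sphere 0 1" "\<sigma> \<one>\<^bsub>G\<^esub> = 1"
      by (auto simp: B2_def)
    have "u \<otimes>\<^bsub>Z2 G\<^esub> v = coboundary G (\<lambda>x. \<rho> x * \<sigma> x)"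
      using r by (auto simp: Z2_def coboundary_def fun_eq_iff restrict_def)
    moreover have "(\<lambda>x. \<rho> x * \<sigma> x) \<in> carrier G \<rightarrow> sphere 0 1" "\<rho> \<one>\<^bsub>G\<^esub> * \<sigma> \<one>\<^bsub>G\<^esub> = 1"
      using r by (auto simp: Pi_iff norm_mult)
    ultimately show "u \<otimes>\<^bsub>Z2 G\<^esub> v \<in> B2 G" by (auto simp: B2_def)
  qed
qed

lemma comm_group_H2:
  assumes "group G" shows "comm_group (H2 G)"
  unfolding H2_def
  using comm_group.abelian_FactGroup[OF comm_group_Z2 subgroup_B2] assms by blast


section \<open>Unconditional infinite products\<close>

text \<open>The net of all finite products, so not the library's \<^const>\<open>has_prod\<close>, which is about the
  sequence of partial products and forbids the limit 0.\<close>

definition has_net_prod :: "(nat \<Rightarrow> complex) \<Rightarrow> complex \<Rightarrow> bool" where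
  "has_net_prod z p \<longleftrightarrow> ((\<lambda>J. \<Prod>i\<in>J. z i) \<longlongrightarrow> p) (finite_subsets_at_top UNIV)"

definition product_sequence ::
    "('a, 'b) monoid_scheme \<Rightarrow> (nat \<Rightarrow> 'a \<times> 'a \<Rightarrow> complex) \<Rightarrow> bool" where
  "product_sequence G u \<longleftrightarrow>
     (\<forall>i. u i \<in> carrier (Z2 G)) \<and>
     (\<forall>x\<in>carrier G. \<forall>y\<in>carrier G. \<exists>p. has_net_prod (\<lambda>i. u i (x, y)) p)"

definition is_product_of ::
    "('a, 'b) monoid_scheme \<Rightarrow> ('a \<times> 'a \<Rightarrow> complex) \<Rightarrow> (nat \<Rightarrow> 'a \<times> 'a \<Rightarrow> complex) \<Rightarrow> bool" where
  "is_product_of G v u \<longleftrightarrow>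
     (\<forall>x\<in>carrier G. \<forall>y\<in>carrier G. has_net_prod (\<lambda>i. u i (x, y)) (v (x, y)))"


section \<open>Square-summable functions and the regular representation\<close>

definition l2 :: "'a set \<Rightarrow> ('a \<Rightarrow> complex) set" where
  "l2 X = {f. (\<forall>x. x \<notin> X \<longrightarrow> f x = 0) \<and> (\<lambda>x. (cmod (f x))\<^sup>2) summable_on X}"

definition l2_norm :: "'a set \<Rightarrow> ('a \<Rightarrow> complex) \<Rightarrow> real" where
  "l2_norm X f = sqrt (\<Sum>\<^sub>\<infinity>x\<in>X. (cmod (f x))\<^sup>2)"

definition regular_rep ::
    "('a, 'b) monoid_scheme \<Rightarrow> ('a \<times> 'a \<Rightarrow> complex) \<Rightarrow> 'a \<Rightarrow> ('a \<Rightarrow> complex) \<Rightarrow> 'a \<Rightarrow> complex" where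
  "regular_rep G u x f =
     (\<lambda>y. if y \<in> carrier G then u (inv\<^bsub>G\<^esub> y, x) * f (inv\<^bsub>G\<^esub> x \<otimes>\<^bsub>G\<^esub> y) else 0)"


section \<open>Infinite tensor products of copies of \<open>\<ell>\<^sup>2(X)\<close>\<close>

text \<open>The \<open>n\<close>-fold Hilbert space tensor power of \<open>\<ell>\<^sup>2(X)\<close> is \<open>\<ell>\<^sup>2(X\<^sup>n)\<close>, with
  \<open>(f\<^sub>0 \<otimes> \<dots> \<otimes> f\<^sub>n\<^sub>-\<^sub>1)(x\<^sub>0, \<dots>, x\<^sub>n\<^sub>-\<^sub>1) = f\<^sub>0(x\<^sub>0) \<cdots> f\<^sub>n\<^sub>-\<^sub>1(x\<^sub>n\<^sub>-\<^sub>1)\<close>.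
  Tuples are lists; factors are numbered from 0.\<close>

definition tuples :: "'a set \<Rightarrow> nat \<Rightarrow> 'a list set" where
  "tuples X n = {xs. length xs = n \<and> set xs \<subseteq> X}"

text \<open>\<open>\<psi> \<otimes> f\<close> for \<open>\<psi> \<in> \<ell>\<^sup>2(X\<^sup>n)\<close> and \<open>f \<in> \<ell>\<^sup>2(X)\<close>:\<close>

definition snoc_tensor :: "('a list \<Rightarrow> complex) \<Rightarrow> ('a \<Rightarrow> complex) \<Rightarrow> 'a list \<Rightarrow> complex" where
  "snoc_tensor \<psi> f = (\<lambda>xs. if xs = [] then 0 else \<psi> (butlast xs) * f (last xs))"

text \<open>\<open>\<psi> \<mapsto> \<psi> \<otimes> \<phi>\<^sub>m \<otimes> \<dots> \<otimes> \<phi>\<^sub>m\<^sub>+\<^sub>k\<^sub>-\<^sub>1\<close>, from level \<open>m\<close> to level \<open>m + k\<close>:\<close>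

primrec level_embed :: "(nat \<Rightarrow> 'a \<Rightarrow> complex) \<Rightarrow> nat \<Rightarrow> nat \<Rightarrow> ('a list \<Rightarrow> complex) \<Rightarrow> 'a list \<Rightarrow> complex" where
  "level_embed \<phi> m 0 \<psi> = \<psi>"
| "level_embed \<phi> m (Suc k) \<psi> = snoc_tensor (level_embed \<phi> m k \<psi>) (\<phi> (m + k))"

text \<open>The completed inductive limit consists of the sequences \<open>\<psi>\<^sub>n \<in> \<ell>\<^sup>2(X\<^sup>n)\<close> which are Cauchy
  in the inductive limit, modulo sequences tending to 0 in norm.  Taking the \<open>n\<close>-th term from
  level \<open>n\<close> is no restriction, since a vector may be moved up to any higher level and terms may be
  repeated.  The theorems \<open>itp_incl_Suc\<close>, \<open>itp_norm_incl\<close>, \<open>itp_incl_dense\<close> and \<open>itp_complete\<close>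
  below confirm that the levels embed compatibly and isometrically, with dense union, into
  a complete space.\<close>

definition itp_cauchy :: "'a set \<Rightarrow> (nat \<Rightarrow> 'a \<Rightarrow> complex) \<Rightarrow> (nat \<Rightarrow> 'a list \<Rightarrow> complex) set" where
  "itp_cauchy X \<phi> = {\<psi>. (\<forall>n. \<psi> n \<in> l2 (tuples X n)) \<and>
     (\<forall>e>0. \<exists>N. \<forall>m\<ge>N. \<forall>k.
        l2_norm (tuples X (m + k)) (\<lambda>xs. \<psi> (m + k) xs - level_embed \<phi> m k (\<psi> m) xs) < e)}"

definition itp_rel :: "'a set \<Rightarrow> (nat \<Rightarrow> 'a \<Rightarrow> complex) \<Rightarrow> (nat \<Rightarrow> 'a list \<Rightarrow> complex) rel" where
  "itp_rel X \<phi> = {(\<psi>, \<eta>). \<psi> \<in> itp_cauchy X \<phi> \<and> \<eta> \<in> itp_cauchy X \<phi> \<and>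
     (\<lambda>n. l2_norm (tuples X n) (\<lambda>xs. \<psi> n xs - \<eta> n xs)) \<longlonglongrightarrow> 0}"

definition itp :: "'a set \<Rightarrow> (nat \<Rightarrow> 'a \<Rightarrow> complex) \<Rightarrow> (nat \<Rightarrow> 'a list \<Rightarrow> complex) set set" where
  "itp X \<phi> = itp_cauchy X \<phi> // itp_rel X \<phi>"

definition itp_class ::
    "'a set \<Rightarrow> (nat \<Rightarrow> 'a \<Rightarrow> complex) \<Rightarrow> (nat \<Rightarrow> 'a list \<Rightarrow> complex) \<Rightarrow> (nat \<Rightarrow> 'a list \<Rightarrow> complex) set" where
  "itp_class X \<phi> \<psi> = itp_rel X \<phi> `` {\<psi>}"

definition itp_add ::
    "'a set \<Rightarrow> (nat \<Rightarrow> 'a \<Rightarrow> complex) \<Rightarrow>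
      (nat \<Rightarrow> 'a list \<Rightarrow> complex) set \<Rightarrow> (nat \<Rightarrow> 'a list \<Rightarrow> complex) set \<Rightarrow> (nat \<Rightarrow> 'a list \<Rightarrow> complex) set" where
  "itp_add X \<phi> a b = (\<Union>\<psi>\<in>a. \<Union>\<eta>\<in>b. itp_class X \<phi> (\<lambda>n xs. \<psi> n xs + \<eta> n xs))"

definition itp_scale ::
    "'a set \<Rightarrow> (nat \<Rightarrow> 'a \<Rightarrow> complex) \<Rightarrow>
      complex \<Rightarrow> (nat \<Rightarrow> 'a list \<Rightarrow> complex) set \<Rightarrow> (nat \<Rightarrow> 'a list \<Rightarrow> complex) set" where
  "itp_scale X \<phi> c a = (\<Union>\<psi>\<in>a. itp_class X \<phi> (\<lambda>n xs. c * \<psi> n xs))"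

definition itp_norm :: "'a set \<Rightarrow> (nat \<Rightarrow> 'a list \<Rightarrow> complex) set \<Rightarrow> real" where
  "itp_norm X a = (THE r. \<forall>\<psi>\<in>a. (\<lambda>n. l2_norm (tuples X n) (\<psi> n)) \<longlonglongrightarrow> r)"

definition itp_dist ::
    "'a set \<Rightarrow> (nat \<Rightarrow> 'a \<Rightarrow> complex) \<Rightarrow>
      (nat \<Rightarrow> 'a list \<Rightarrow> complex) set \<Rightarrow> (nat \<Rightarrow> 'a list \<Rightarrow> complex) set \<Rightarrow> real" where
  "itp_dist X \<phi> a b = itp_norm X (itp_add X \<phi> a (itp_scale X \<phi> (-1) b))"

text \<open>The canonical isometry of level \<open>m\<close> into the completed inductive limit:\<close>

definition itp_incl ::
    "'a set \<Rightarrow> (nat \<Rightarrow> 'a \<Rightarrow> complex) \<Rightarrow>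
      nat \<Rightarrow> ('a list \<Rightarrow> complex) \<Rightarrow> (nat \<Rightarrow> 'a list \<Rightarrow> complex) set" where
  "itp_incl X \<phi> m \<psi> = itp_class X \<phi> (\<lambda>n. if n < m then (\<lambda>_. 0) else level_embed \<phi> m (n - m) \<psi>)"


lemma l2_norm_sq: "(l2_norm X f)\<^sup>2 = (\<Sum>\<^sub>\<infinity>x\<in>X. (cmod (f x))\<^sup>2)"
  unfolding l2_norm_def by (intro real_sqrt_pow2 infsum_nonneg) simp

lemma l2_norm_nonneg: "0 \<le> l2_norm X f"
  unfolding l2_norm_def by (intro real_sqrt_ge_zero infsum_nonneg) simp

lemma l2_norm_zero: "l2_norm X (\<lambda>x. 0) = 0"
  by (simp add: l2_norm_def)

lemma l2_zero: "(\<lambda>x. 0) \<in> l2 X"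
  by (simp add: l2_def)

lemma l2_scale: "f \<in> l2 X \<Longrightarrow> (\<lambda>x. c * f x) \<in> l2 X"
  by (auto simp: l2_def norm_mult power_mult_distrib intro: summable_on_cmult_right)

lemma l2_norm_scale: "l2_norm X (\<lambda>x. c * f x) = cmod c * l2_norm X f"
  by (simp add: l2_norm_def norm_mult power_mult_distrib infsum_cmult_right' real_sqrt_mult)

lemma l2_norm_minus_commute: "l2_norm X (\<lambda>x. f x - g x) = l2_norm X (\<lambda>x. g x - f x)"
  by (simp add: l2_norm_def norm_minus_commute)

lemma L2_set_le_l2_norm:
  assumes "f \<in> l2 X" "finite F" "F \<subseteq> X"
  shows "L2_set (\<lambda>x. cmod (f x)) F \<le> l2_norm X f"
  unfolding L2_set_def l2_norm_def using assms
  by (intro real_sqrt_le_mono finite_sum_le_infsum) (auto simp: l2_def)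

lemma l2_add_aux:
  assumes "f \<in> l2 X" "g \<in> l2 X" "finite F" "F \<subseteq> X"
  shows "(\<Sum>x\<in>F. (cmod (f x + g x))\<^sup>2) \<le> (l2_norm X f + l2_norm X g)\<^sup>2"
proof -
  have "L2_set (\<lambda>x. cmod (f x + g x)) F \<le> L2_set (\<lambda>x. cmod (f x) + cmod (g x)) F"
    by (intro L2_set_mono norm_triangle_ineq) auto
  also have "\<dots> \<le> L2_set (\<lambda>x. cmod (f x)) F + L2_set (\<lambda>x. cmod (g x)) F"
    by (rule L2_set_triangle_ineq)
  also have "\<dots> \<le> l2_norm X f + l2_norm X g"
    using assms by (intro add_mono L2_set_le_l2_norm)
  finally have "(L2_set (\<lambda>x. cmod (f x + g x)) F)\<^sup>2 \<le> (l2_norm X f + l2_norm X g)\<^sup>2"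
    by (intro power_mono) (auto simp: L2_set_nonneg)
  then show ?thesis by (simp add: L2_set_def sum_nonneg)
qed

lemma l2_add:
  assumes "f \<in> l2 X" "g \<in> l2 X" shows "(\<lambda>x. f x + g x) \<in> l2 X"
proof -
  have "(\<lambda>x. (cmod (f x + g x))\<^sup>2) summable_on X"
    using l2_add_aux[OF assms] by (intro nonneg_bdd_above_summable_on bdd_aboveI2) auto
  then show ?thesis using assms by (simp add: l2_def)
qed

lemma l2_norm_triangle:
  assumes "f \<in> l2 X" "g \<in> l2 X"
  shows "l2_norm X (\<lambda>x. f x + g x) \<le> l2_norm X f + l2_norm X g"
proof -
  have "(\<Sum>\<^sub>\<infinity>x\<in>X. (cmod (f x + g x))\<^sup>2) \<le> (l2_norm X f + l2_norm X g)\<^sup>2"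
    using l2_add[OF assms] l2_add_aux[OF assms] by (intro infsum_le_finite_sums) (auto simp: l2_def)
  then have "sqrt (\<Sum>\<^sub>\<infinity>x\<in>X. (cmod (f x + g x))\<^sup>2) \<le> sqrt ((l2_norm X f + l2_norm X g)\<^sup>2)"
    by (rule real_sqrt_le_mono)
  then show ?thesis by (simp add: l2_norm_def[of X "\<lambda>x. f x + g x"] l2_norm_nonneg)
qed

lemma l2_diff: "f \<in> l2 X \<Longrightarrow> g \<in> l2 X \<Longrightarrow> (\<lambda>x. f x - g x) \<in> l2 X"
  using l2_add[OF _ l2_scale[of g X "-1"], of f] by simp

lemma l2_norm_triangle_diff:
  assumes "f \<in> l2 X" "g \<in> l2 X" "h \<in> l2 X"
  shows "l2_norm X (\<lambda>x. f x - h x) \<le> l2_norm X (\<lambda>x. f x - g x) + l2_norm X (\<lambda>x. g x - h x)"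
  using l2_norm_triangle[OF l2_diff[OF assms(1,2)] l2_diff[OF assms(2,3)]] by simp

lemma l2_norm_reverse_triangle:
  assumes "f \<in> l2 X" "g \<in> l2 X"
  shows "\<bar>l2_norm X f - l2_norm X g\<bar> \<le> l2_norm X (\<lambda>x. f x - g x)"
  using l2_norm_triangle_diff[OF assms l2_zero] l2_norm_triangle_diff[OF assms(2,1) l2_zero]
    l2_norm_minus_commute[of X f g] by simp

lemma snoc_tensor_has_sum:
  assumes "\<psi> \<in> l2 (tuples X n)" "f \<in> l2 X"
  shows "((\<lambda>xs. (cmod (snoc_tensor \<psi> f xs))\<^sup>2) has_sum
           (l2_norm (tuples X n) \<psi>)\<^sup>2 * (l2_norm X f)\<^sup>2) (tuples X (Suc n))"
proof -
  let ?h = "\<lambda>p. (cmod (\<psi> (fst p)))\<^sup>2 * (cmod (f (snd p)))\<^sup>2"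
  have s1: "((\<lambda>xs. (cmod (\<psi> xs))\<^sup>2) has_sum (l2_norm (tuples X n) \<psi>)\<^sup>2) (tuples X n)"
    using assms(1) by (simp add: l2_def l2_norm_sq)
  have s2: "((\<lambda>x. (cmod (f x))\<^sup>2) has_sum (l2_norm X f)\<^sup>2) X"
    using assms(2) by (simp add: l2_def l2_norm_sq)
  have a: "((\<lambda>x. ?h (xs, x)) has_sum (cmod (\<psi> xs))\<^sup>2 * (l2_norm X f)\<^sup>2) X" for xs
    using has_sum_cmult_right[OF s2] by simp
  have b: "((\<lambda>xs. (cmod (\<psi> xs))\<^sup>2 * (l2_norm X f)\<^sup>2) has_sum
      (l2_norm (tuples X n) \<psi>)\<^sup>2 * (l2_norm X f)\<^sup>2) (tuples X n)"
    by (rule has_sum_cmult_left[OF s1])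
  have "(?h has_sum (l2_norm (tuples X n) \<psi>)\<^sup>2 * (l2_norm X f)\<^sup>2) (tuples X n \<times> X)"
    using a b by (intro has_sum_SigmaI[OF a b] summable_on_SigmaI[OF a has_sum_imp_summable[OF b]]) auto
  moreover have "((\<lambda>xs. (cmod (snoc_tensor \<psi> f xs))\<^sup>2) has_sum
           (l2_norm (tuples X n) \<psi>)\<^sup>2 * (l2_norm X f)\<^sup>2) (tuples X (Suc n)) \<longleftrightarrow>
        (?h has_sum (l2_norm (tuples X n) \<psi>)\<^sup>2 * (l2_norm X f)\<^sup>2) (tuples X n \<times> X)"
  proof (rule has_sum_reindex_bij_witness[where
        i = "\<lambda>p. fst p @ [snd p]" and j = "\<lambda>xs. (butlast xs, last xs)"], goal_cases)
    case (1 xs) then show ?case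
      by (cases xs rule: rev_cases) (auto simp: tuples_def)
  next
    case (2 xs) then show ?case
      by (cases xs rule: rev_cases) (auto simp: tuples_def)
  next
    case (5 xs) then show ?case
      by (cases xs rule: rev_cases) (auto simp: tuples_def snoc_tensor_def norm_mult power_mult_distrib)
  qed (auto simp: tuples_def)
  ultimately show ?thesis by blast
qed

lemma snoc_tensor_l2:
  assumes "\<psi> \<in> l2 (tuples X n)" "f \<in> l2 X"
  shows "snoc_tensor \<psi> f \<in> l2 (tuples X (Suc n))"
proof -
  have "snoc_tensor \<psi> f xs = 0" if "xs \<notin> tuples X (Suc n)" for xs
  proof (cases xs rule: rev_cases)
    case (snoc ys y)
    then have "ys \<notin> tuples X n \<or> y \<notin> X" using that by (auto simp: tuples_def)
    then show ?thesis using snoc assms by (auto simp: snoc_tensor_def l2_def)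
  qed (simp add: snoc_tensor_def)
  then show ?thesis
    using has_sum_imp_summable[OF snoc_tensor_has_sum[OF assms]] by (simp add: l2_def)
qed

lemma snoc_tensor_norm:
  assumes "\<psi> \<in> l2 (tuples X n)" "f \<in> l2 X"
  shows "l2_norm (tuples X (Suc n)) (snoc_tensor \<psi> f) = l2_norm (tuples X n) \<psi> * l2_norm X f"
  using infsumI[OF snoc_tensor_has_sum[OF assms]]
  by (simp add: l2_norm_def[of "tuples X (Suc n)"] real_sqrt_mult l2_norm_nonneg)

lemma level_embed_add: "level_embed \<phi> m k (\<lambda>xs. \<psi> xs + \<eta> xs) = (\<lambda>xs. level_embed \<phi> m k \<psi> xs + level_embed \<phi> m k \<eta> xs)"
  by (induction k) (auto simp: snoc_tensor_def fun_eq_iff algebra_simps)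

lemma level_embed_scale: "level_embed \<phi> m k (\<lambda>xs. c * \<psi> xs) = (\<lambda>xs. c * level_embed \<phi> m k \<psi> xs)"
  by (induction k) (auto simp: snoc_tensor_def fun_eq_iff algebra_simps)

lemma level_embed_diff: "level_embed \<phi> m k (\<lambda>xs. \<psi> xs - \<eta> xs) = (\<lambda>xs. level_embed \<phi> m k \<psi> xs - level_embed \<phi> m k \<eta> xs)"
  using level_embed_add[of \<phi> m k \<psi> "\<lambda>xs. -1 * \<eta> xs"] level_embed_scale[of \<phi> m k "-1" \<eta>] by simp

lemma level_embed_zero: "level_embed \<phi> m k (\<lambda>xs. 0) = (\<lambda>xs. 0)"
  by (induction k) (auto simp: snoc_tensor_def fun_eq_iff)

lemma level_embed_embed: "level_embed \<phi> (m + j) k (level_embed \<phi> m j \<psi>) = level_embed \<phi> m (j + k) \<psi>"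
  by (induction k) (simp_all add: add.assoc)

context
  fixes X :: "'a set" and \<phi> :: "nat \<Rightarrow> 'a \<Rightarrow> complex"
  assumes unit: "\<And>i. \<phi> i \<in> l2 X" "\<And>i. l2_norm X (\<phi> i) = 1"
begin

lemma level_embed_l2: "\<psi> \<in> l2 (tuples X m) \<Longrightarrow> level_embed \<phi> m k \<psi> \<in> l2 (tuples X (m + k))"
  using unit by (induction k) (simp_all add: snoc_tensor_l2)

lemma level_embed_norm:
  "\<psi> \<in> l2 (tuples X m) \<Longrightarrow> l2_norm (tuples X (m + k)) (level_embed \<phi> m k \<psi>) = l2_norm (tuples X m) \<psi>"
  using unit by (induction k) (simp_all add: snoc_tensor_norm level_embed_l2)

lemma itp_cauchyD_l2: "\<psi> \<in> itp_cauchy X \<phi> \<Longrightarrow> \<psi> n \<in> l2 (tuples X n)"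
  by (simp add: itp_cauchy_def)

lemma itp_cauchyD:
  assumes "\<psi> \<in> itp_cauchy X \<phi>" "e > 0"
  obtains N where "\<And>m k. m \<ge> N \<Longrightarrow>
    l2_norm (tuples X (m + k)) (\<lambda>xs. \<psi> (m + k) xs - level_embed \<phi> m k (\<psi> m) xs) < e"
  using assms unfolding itp_cauchy_def by blast

lemma itp_cauchy_add:
  assumes "\<psi> \<in> itp_cauchy X \<phi>" "\<eta> \<in> itp_cauchy X \<phi>"
  shows "(\<lambda>n xs. \<psi> n xs + \<eta> n xs) \<in> itp_cauchy X \<phi>"
  unfolding itp_cauchy_def
proof (intro CollectI conjI allI impI)
  show "(\<lambda>xs. \<psi> n xs + \<eta> n xs) \<in> l2 (tuples X n)" for n
    using assms by (intro l2_add itp_cauchyD_l2)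
  fix e :: real assume "e > 0"
  then have e: "e / 2 > 0" by simp
  obtain M where M: "\<And>m k. m \<ge> M \<Longrightarrow>
      l2_norm (tuples X (m + k)) (\<lambda>xs. \<psi> (m + k) xs - level_embed \<phi> m k (\<psi> m) xs) < e / 2"
    by (rule itp_cauchyD[OF assms(1) e]) blast
  obtain N where N: "\<And>m k. m \<ge> N \<Longrightarrow>
      l2_norm (tuples X (m + k)) (\<lambda>xs. \<eta> (m + k) xs - level_embed \<phi> m k (\<eta> m) xs) < e / 2"
    by (rule itp_cauchyD[OF assms(2) e]) blast
  show "\<exists>N. \<forall>m\<ge>N. \<forall>k. l2_norm (tuples X (m + k)) (\<lambda>xs. \<psi> (m + k) xs + \<eta> (m + k) xs -
      level_embed \<phi> m k (\<lambda>xs. \<psi> m xs + \<eta> m xs) xs) < e"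
  proof (intro exI allI impI)
    fix m k assume m: "max M N \<le> m"
    have "l2_norm (tuples X (m + k)) (\<lambda>xs. (\<psi> (m + k) xs - level_embed \<phi> m k (\<psi> m) xs) +
        (\<eta> (m + k) xs - level_embed \<phi> m k (\<eta> m) xs)) < e / 2 + e / 2"
      using m M N assms
      by (intro le_less_trans[OF l2_norm_triangle] add_strict_mono l2_diff level_embed_l2 itp_cauchyD_l2) auto
    then show "l2_norm (tuples X (m + k)) (\<lambda>xs. \<psi> (m + k) xs + \<eta> (m + k) xs -
      level_embed \<phi> m k (\<lambda>xs. \<psi> m xs + \<eta> m xs) xs) < e"
      by (simp add: level_embed_add algebra_simps)
  qed
qed

lemma itp_cauchy_scale:
  assumes "\<psi> \<in> itp_cauchy X \<phi>"
  shows "(\<lambda>n xs. c * \<psi> n xs) \<in> itp_cauchy X \<phi>"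
  unfolding itp_cauchy_def
proof (intro CollectI conjI allI impI)
  show "(\<lambda>xs. c * \<psi> n xs) \<in> l2 (tuples X n)" for n
    using assms by (intro l2_scale itp_cauchyD_l2)
  fix e :: real assume e: "e > 0"
  then have "e / (cmod c + 1) > 0" by (simp add: add_nonneg_pos)
  then obtain N where N: "\<And>m k. m \<ge> N \<Longrightarrow>
      l2_norm (tuples X (m + k)) (\<lambda>xs. \<psi> (m + k) xs - level_embed \<phi> m k (\<psi> m) xs) < e / (cmod c + 1)"
    by (rule itp_cauchyD[OF assms]) blast
  show "\<exists>N. \<forall>m\<ge>N. \<forall>k. l2_norm (tuples X (m + k)) (\<lambda>xs. c * \<psi> (m + k) xs -
      level_embed \<phi> m k (\<lambda>xs. c * \<psi> m xs) xs) < e"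
  proof (intro exI allI impI)
    fix m k assume m: "N \<le> m"
    let ?d = "l2_norm (tuples X (m + k)) (\<lambda>xs. \<psi> (m + k) xs - level_embed \<phi> m k (\<psi> m) xs)"
    have "cmod c * ?d \<le> (cmod c + 1) * ?d" by (intro mult_right_mono) (auto simp: l2_norm_nonneg)
    also have "\<dots> < e"
      using N[OF m, of k] by (simp add: pos_less_divide_eq add_nonneg_pos mult.commute)
    finally show "l2_norm (tuples X (m + k)) (\<lambda>xs. c * \<psi> (m + k) xs -
      level_embed \<phi> m k (\<lambda>xs. c * \<psi> m xs) xs) < e"
      by (simp add: level_embed_scale l2_norm_scale flip: right_diff_distrib)
  qed
qed

lemma itp_cauchy_diff:
  assumes "\<psi> \<in> itp_cauchy X \<phi>" "\<eta> \<in> itp_cauchy X \<phi>"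
  shows "(\<lambda>n xs. \<psi> n xs - \<eta> n xs) \<in> itp_cauchy X \<phi>"
  using itp_cauchy_add[OF assms(1) itp_cauchy_scale[OF assms(2), of "-1"]] by simp

lemma itp_cauchy_norm_convergent:
  assumes "\<psi> \<in> itp_cauchy X \<phi>"
  shows "convergent (\<lambda>n. l2_norm (tuples X n) (\<psi> n))"
proof (rule Cauchy_convergent, rule metric_CauchyI)
  fix e :: real assume "e > 0"
  then have "e / 2 > 0" by simp
  then obtain N where N: "\<And>m k. m \<ge> N \<Longrightarrow>
      l2_norm (tuples X (m + k)) (\<lambda>xs. \<psi> (m + k) xs - level_embed \<phi> m k (\<psi> m) xs) < e / 2"
    by (rule itp_cauchyD[OF assms]) blast
  have *: "\<bar>l2_norm (tuples X n) (\<psi> n) - l2_norm (tuples X N) (\<psi> N)\<bar> < e / 2" if "n \<ge> N" for n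
  proof -
    from that obtain k where n: "n = N + k" by (metis le_Suc_ex)
    have "\<bar>l2_norm (tuples X n) (\<psi> n) - l2_norm (tuples X n) (level_embed \<phi> N k (\<psi> N))\<bar> < e / 2"
      unfolding n using N[of N k]
      by (intro le_less_trans[OF l2_norm_reverse_triangle] level_embed_l2 itp_cauchyD_l2[OF assms]) simp
    then show ?thesis unfolding n by (simp add: level_embed_norm[OF itp_cauchyD_l2[OF assms]])
  qed
  show "\<exists>N. \<forall>m\<ge>N. \<forall>n\<ge>N. dist (l2_norm (tuples X m) (\<psi> m)) (l2_norm (tuples X n) (\<psi> n)) < e"
  proof (intro exI allI impI)
    fix m n assume mn: "N \<le> m" "N \<le> n"
    show "dist (l2_norm (tuples X m) (\<psi> m)) (l2_norm (tuples X n) (\<psi> n)) < e"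
      using *[OF mn(1)] *[OF mn(2)] unfolding dist_real_def by linarith
  qed
qed

lemma equiv_itp_rel: "equiv (itp_cauchy X \<phi>) (itp_rel X \<phi>)"
proof (rule equivI)
  show "itp_rel X \<phi> \<subseteq> itp_cauchy X \<phi> \<times> itp_cauchy X \<phi>" by (auto simp: itp_rel_def)
  show "refl_on (itp_cauchy X \<phi>) (itp_rel X \<phi>)"
    by (auto simp: refl_on_def itp_rel_def l2_norm_zero)
  show "sym (itp_rel X \<phi>)"
  proof (rule symI)
    fix \<psi> \<eta> assume "(\<psi>, \<eta>) \<in> itp_rel X \<phi>"
    then show "(\<eta>, \<psi>) \<in> itp_rel X \<phi>"
      by (simp add: itp_rel_def l2_norm_minus_commute[of _ "\<eta> n" "\<psi> n" for n])
  qed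
  show "trans (itp_rel X \<phi>)"
  proof (rule transI)
    fix \<psi> \<eta> \<theta> assume r: "(\<psi>, \<eta>) \<in> itp_rel X \<phi>" "(\<eta>, \<theta>) \<in> itp_rel X \<phi>"
    then have c: "\<psi> \<in> itp_cauchy X \<phi>" "\<eta> \<in> itp_cauchy X \<phi>" "\<theta> \<in> itp_cauchy X \<phi>"
      by (auto simp: itp_rel_def)
    have "(\<lambda>n. l2_norm (tuples X n) (\<lambda>xs. \<psi> n xs - \<eta> n xs) +
        l2_norm (tuples X n) (\<lambda>xs. \<eta> n xs - \<theta> n xs)) \<longlonglongrightarrow> 0 + 0"
      using r by (intro tendsto_add) (auto simp: itp_rel_def)
    then have lim: "(\<lambda>n. l2_norm (tuples X n) (\<lambda>xs. \<psi> n xs - \<eta> n xs) +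
        l2_norm (tuples X n) (\<lambda>xs. \<eta> n xs - \<theta> n xs)) \<longlonglongrightarrow> 0" by simp
    have "\<forall>n. norm (l2_norm (tuples X n) (\<lambda>xs. \<psi> n xs - \<theta> n xs)) \<le>
        l2_norm (tuples X n) (\<lambda>xs. \<psi> n xs - \<eta> n xs) + l2_norm (tuples X n) (\<lambda>xs. \<eta> n xs - \<theta> n xs)"
    proof
      fix n
      show "norm (l2_norm (tuples X n) (\<lambda>xs. \<psi> n xs - \<theta> n xs)) \<le>
        l2_norm (tuples X n) (\<lambda>xs. \<psi> n xs - \<eta> n xs) + l2_norm (tuples X n) (\<lambda>xs. \<eta> n xs - \<theta> n xs)"
        using l2_norm_triangle_diff[OF itp_cauchyD_l2[OF c(1), of n] itp_cauchyD_l2[OF c(2), of n]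
            itp_cauchyD_l2[OF c(3), of n]] by (simp add: l2_norm_nonneg)
    qed
    from Lim_null_comparison[OF always_eventually[OF this] lim]
    have "(\<lambda>n. l2_norm (tuples X n) (\<lambda>xs. \<psi> n xs - \<theta> n xs)) \<longlonglongrightarrow> 0" .
    then show "(\<psi>, \<theta>) \<in> itp_rel X \<phi>" using c by (simp add: itp_rel_def)
  qed
qed

lemma itp_class_in: "\<psi> \<in> itp_cauchy X \<phi> \<Longrightarrow> itp_class X \<phi> \<psi> \<in> itp X \<phi>"
  by (simp add: itp_class_def itp_def quotientI)

lemma itp_cases:
  assumes "a \<in> itp X \<phi>"
  obtains \<psi> where "\<psi> \<in> itp_cauchy X \<phi>" "a = itp_class X \<phi> \<psi>"
  using assms that unfolding itp_def itp_class_def[abs_def] by (auto elim: quotientE)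

lemma itp_class_eq_iff:
  assumes "\<psi> \<in> itp_cauchy X \<phi>" "\<eta> \<in> itp_cauchy X \<phi>"
  shows "itp_class X \<phi> \<psi> = itp_class X \<phi> \<eta> \<longleftrightarrow> (\<psi>, \<eta>) \<in> itp_rel X \<phi>"
  unfolding itp_class_def by (rule eq_equiv_class_iff[OF equiv_itp_rel assms])

lemma itp_add_class:
  assumes "\<psi> \<in> itp_cauchy X \<phi>" "\<eta> \<in> itp_cauchy X \<phi>"
  shows "itp_add X \<phi> (itp_class X \<phi> \<psi>) (itp_class X \<phi> \<eta>) = itp_class X \<phi> (\<lambda>n xs. \<psi> n xs + \<eta> n xs)"
  unfolding itp_add_def itp_class_def[of X \<phi> \<psi>] itp_class_def[of X \<phi> \<eta>]
proof (rule UN_equiv_class2[OF equiv_itp_rel equiv_itp_rel _ assms], rule congruent2I')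
  fix \<psi> \<psi>' \<eta> \<eta>' assume r: "(\<psi>, \<psi>') \<in> itp_rel X \<phi>" "(\<eta>, \<eta>') \<in> itp_rel X \<phi>"
  then have c: "\<psi> \<in> itp_cauchy X \<phi>" "\<psi>' \<in> itp_cauchy X \<phi>" "\<eta> \<in> itp_cauchy X \<phi>" "\<eta>' \<in> itp_cauchy X \<phi>"
    by (auto simp: itp_rel_def)
  have "(\<lambda>n. l2_norm (tuples X n) (\<lambda>xs. \<psi> n xs - \<psi>' n xs) +
      l2_norm (tuples X n) (\<lambda>xs. \<eta> n xs - \<eta>' n xs)) \<longlonglongrightarrow> 0 + 0"
    using r by (intro tendsto_add) (auto simp: itp_rel_def)
  then have lim: "(\<lambda>n. l2_norm (tuples X n) (\<lambda>xs. \<psi> n xs - \<psi>' n xs) +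
      l2_norm (tuples X n) (\<lambda>xs. \<eta> n xs - \<eta>' n xs)) \<longlonglongrightarrow> 0" by simp
  have "norm (l2_norm (tuples X n) (\<lambda>xs. \<psi> n xs + \<eta> n xs - (\<psi>' n xs + \<eta>' n xs))) \<le>
      l2_norm (tuples X n) (\<lambda>xs. \<psi> n xs - \<psi>' n xs) + l2_norm (tuples X n) (\<lambda>xs. \<eta> n xs - \<eta>' n xs)" for n
  proof -
    have "l2_norm (tuples X n) (\<lambda>xs. (\<psi> n xs - \<psi>' n xs) + (\<eta> n xs - \<eta>' n xs)) \<le>
        l2_norm (tuples X n) (\<lambda>xs. \<psi> n xs - \<psi>' n xs) + l2_norm (tuples X n) (\<lambda>xs. \<eta> n xs - \<eta>' n xs)"
      by (rule l2_norm_triangle[OF l2_diff[OF c(1,2)[THEN itp_cauchyD_l2]]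
            l2_diff[OF c(3,4)[THEN itp_cauchyD_l2]]])
    then show ?thesis by (simp add: l2_norm_nonneg algebra_simps)
  qed
  then have "\<forall>n. norm (l2_norm (tuples X n) (\<lambda>xs. \<psi> n xs + \<eta> n xs - (\<psi>' n xs + \<eta>' n xs))) \<le>
      l2_norm (tuples X n) (\<lambda>xs. \<psi> n xs - \<psi>' n xs) + l2_norm (tuples X n) (\<lambda>xs. \<eta> n xs - \<eta>' n xs)"
    by (rule allI)
  from Lim_null_comparison[OF always_eventually[OF this] lim]
  have "(\<lambda>n. l2_norm (tuples X n) (\<lambda>xs. \<psi> n xs + \<eta> n xs - (\<psi>' n xs + \<eta>' n xs))) \<longlonglongrightarrow> 0" .
  then show "itp_class X \<phi> (\<lambda>n xs. \<psi> n xs + \<eta> n xs) = itp_class X \<phi> (\<lambda>n xs. \<psi>' n xs + \<eta>' n xs)"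
    using c by (subst itp_class_eq_iff) (auto simp: itp_rel_def intro: itp_cauchy_add)
qed

lemma itp_scale_class:
  assumes "\<psi> \<in> itp_cauchy X \<phi>"
  shows "itp_scale X \<phi> c (itp_class X \<phi> \<psi>) = itp_class X \<phi> (\<lambda>n xs. c * \<psi> n xs)"
  unfolding itp_scale_def itp_class_def[of X \<phi> \<psi>]
proof (rule UN_equiv_class[OF equiv_itp_rel _ assms], rule congruentI)
  fix \<psi> \<eta> assume r: "(\<psi>, \<eta>) \<in> itp_rel X \<phi>"
  then have c: "\<psi> \<in> itp_cauchy X \<phi>" "\<eta> \<in> itp_cauchy X \<phi>" by (auto simp: itp_rel_def)
  have "(\<lambda>n. cmod c * l2_norm (tuples X n) (\<lambda>xs. \<psi> n xs - \<eta> n xs)) \<longlonglongrightarrow> cmod c * 0"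
    using r by (intro tendsto_intros) (auto simp: itp_rel_def)
  then have "(\<lambda>n. l2_norm (tuples X n) (\<lambda>xs. c * \<psi> n xs - c * \<eta> n xs)) \<longlonglongrightarrow> 0"
    by (simp add: l2_norm_scale flip: right_diff_distrib)
  then show "itp_class X \<phi> (\<lambda>n xs. c * \<psi> n xs) = itp_class X \<phi> (\<lambda>n xs. c * \<eta> n xs)"
    using c by (subst itp_class_eq_iff) (auto simp: itp_rel_def intro: itp_cauchy_scale)
qed

lemma itp_norm_class:
  assumes "\<psi> \<in> itp_cauchy X \<phi>"
  shows "(\<lambda>n. l2_norm (tuples X n) (\<psi> n)) \<longlonglongrightarrow> itp_norm X (itp_class X \<phi> \<psi>)"
proof -
  obtain r where r: "(\<lambda>n. l2_norm (tuples X n) (\<psi> n)) \<longlonglongrightarrow> r"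
    using itp_cauchy_norm_convergent[OF assms] by (auto simp: convergent_def)
  have "(\<lambda>n. l2_norm (tuples X n) (\<eta> n)) \<longlonglongrightarrow> r" if "\<eta> \<in> itp_class X \<phi> \<psi>" for \<eta>
  proof -
    have rel: "(\<psi>, \<eta>) \<in> itp_rel X \<phi>" using that by (simp add: itp_class_def)
    then have c: "\<eta> \<in> itp_cauchy X \<phi>" by (simp add: itp_rel_def)
    have "(\<lambda>n. l2_norm (tuples X n) (\<eta> n) - l2_norm (tuples X n) (\<psi> n)) \<longlonglongrightarrow> 0"
    proof (rule Lim_null_comparison[OF always_eventually])
      show "\<forall>n. norm (l2_norm (tuples X n) (\<eta> n) - l2_norm (tuples X n) (\<psi> n)) \<le>
          l2_norm (tuples X n) (\<lambda>xs. \<psi> n xs - \<eta> n xs)"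
        using l2_norm_reverse_triangle[OF itp_cauchyD_l2[OF assms] itp_cauchyD_l2[OF c]]
        by (simp add: abs_minus_commute)
      show "(\<lambda>n. l2_norm (tuples X n) (\<lambda>xs. \<psi> n xs - \<eta> n xs)) \<longlonglongrightarrow> 0"
        using rel by (simp add: itp_rel_def)
    qed
    from tendsto_add[OF this r] show ?thesis by simp
  qed
  moreover have "\<psi> \<in> itp_class X \<phi> \<psi>"
    unfolding itp_class_def using equiv_class_self[OF equiv_itp_rel assms] .
  ultimately have "itp_norm X (itp_class X \<phi> \<psi>) = r"
    unfolding itp_norm_def by (intro the_equality ballI) (auto intro: LIMSEQ_unique[OF _ r])
  then show ?thesis using r by simp
qed

lemma itp_dist_class:
  assumes "\<psi> \<in> itp_cauchy X \<phi>" "\<eta> \<in> itp_cauchy X \<phi>"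
  shows "(\<lambda>n. l2_norm (tuples X n) (\<lambda>xs. \<psi> n xs - \<eta> n xs)) \<longlonglongrightarrow>
           itp_dist X \<phi> (itp_class X \<phi> \<psi>) (itp_class X \<phi> \<eta>)"
  using itp_norm_class[OF itp_cauchy_diff[OF assms]] assms itp_cauchy_scale[OF assms(2), of "-1"]
  by (simp add: itp_dist_def itp_scale_class itp_add_class)

lemma itp_incl_cauchy:
  assumes "\<psi> \<in> l2 (tuples X m)"
  shows "(\<lambda>n. if n < m then (\<lambda>_. 0) else level_embed \<phi> m (n - m) \<psi>) \<in> itp_cauchy X \<phi>"
  unfolding itp_cauchy_def
proof (intro CollectI conjI allI impI)
  fix n show "(if n < m then (\<lambda>_. 0) else level_embed \<phi> m (n - m) \<psi>) \<in> l2 (tuples X n)"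
    using level_embed_l2[OF assms, of "n - m"] by (auto simp: l2_zero)
next
  fix e :: real assume e: "e > 0"
  show "\<exists>N. \<forall>p\<ge>N. \<forall>k. l2_norm (tuples X (p + k))
     (\<lambda>xs. (if p + k < m then (\<lambda>_. 0) else level_embed \<phi> m (p + k - m) \<psi>) xs -
        level_embed \<phi> p k (if p < m then (\<lambda>_. 0) else level_embed \<phi> m (p - m) \<psi>) xs) < e"
  proof (intro exI allI impI)
    fix p k assume "m \<le> p"
    then show "l2_norm (tuples X (p + k))
     (\<lambda>xs. (if p + k < m then (\<lambda>_. 0) else level_embed \<phi> m (p + k - m) \<psi>) xs -
        level_embed \<phi> p k (if p < m then (\<lambda>_. 0) else level_embed \<phi> m (p - m) \<psi>) xs) < e"
      using e level_embed_embed[of \<phi> m "p - m" k \<psi>] by (simp add: l2_norm_zero)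
  qed
qed

theorem itp_incl_Suc:
  assumes "\<psi> \<in> l2 (tuples X m)"
  shows "itp_incl X \<phi> (Suc m) (snoc_tensor \<psi> (\<phi> m)) = itp_incl X \<phi> m \<psi>"
proof -
  let ?f = "\<lambda>n. if n < Suc m then (\<lambda>_. 0) else level_embed \<phi> (Suc m) (n - Suc m) (snoc_tensor \<psi> (\<phi> m))"
  let ?g = "\<lambda>n. if n < m then (\<lambda>_. 0) else level_embed \<phi> m (n - m) \<psi>"
  have "?f n = ?g n" if "n \<ge> Suc m" for n
    using that level_embed_embed[of \<phi> m 1 "n - Suc m" \<psi>] by (simp add: Suc_diff_Suc)
  then have "eventually (\<lambda>n. l2_norm (tuples X n) (\<lambda>xs. ?f n xs - ?g n xs) = 0) sequentially"
    by (intro eventually_sequentiallyI[of "Suc m"]) (simp add: l2_norm_zero)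
  then have "(\<lambda>n. l2_norm (tuples X n) (\<lambda>xs. ?f n xs - ?g n xs)) \<longlonglongrightarrow> 0"
    by (rule tendsto_eventually)
  then show ?thesis
    unfolding itp_incl_def
    using itp_incl_cauchy[OF assms] itp_incl_cauchy[OF snoc_tensor_l2[OF assms unit(1)]]
    by (subst itp_class_eq_iff) (simp_all add: itp_rel_def)
qed

theorem itp_norm_incl:
  assumes "\<psi> \<in> l2 (tuples X m)"
  shows "itp_norm X (itp_incl X \<phi> m \<psi>) = l2_norm (tuples X m) \<psi>"
proof (rule LIMSEQ_unique)
  let ?f = "\<lambda>n. if n < m then (\<lambda>_. 0) else level_embed \<phi> m (n - m) \<psi>"
  show "(\<lambda>n. l2_norm (tuples X n) (?f n)) \<longlonglongrightarrow> itp_norm X (itp_incl X \<phi> m \<psi>)"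
    unfolding itp_incl_def by (rule itp_norm_class[OF itp_incl_cauchy[OF assms]])
  have "l2_norm (tuples X n) (?f n) = l2_norm (tuples X m) \<psi>" if "n \<ge> m" for n
    using that level_embed_norm[OF assms, of "n - m"] by simp
  then show "(\<lambda>n. l2_norm (tuples X n) (?f n)) \<longlonglongrightarrow> l2_norm (tuples X m) \<psi>"
    by (intro tendsto_eventually eventually_sequentiallyI[of m])
qed

theorem itp_incl_dense:
  assumes "a \<in> itp X \<phi>" "e > 0"
  shows "\<exists>m. \<exists>\<psi>\<in>l2 (tuples X m). itp_dist X \<phi> a (itp_incl X \<phi> m \<psi>) < e"
proof -
  obtain \<psi> where \<psi>: "\<psi> \<in> itp_cauchy X \<phi>" "a = itp_class X \<phi> \<psi>"
    by (rule itp_cases[OF assms(1)])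
  have "e / 2 > 0" using assms(2) by simp
  then obtain N where N: "\<And>m k. m \<ge> N \<Longrightarrow>
      l2_norm (tuples X (m + k)) (\<lambda>xs. \<psi> (m + k) xs - level_embed \<phi> m k (\<psi> m) xs) < e / 2"
    by (rule itp_cauchyD[OF \<psi>(1)]) blast
  have l: "\<psi> N \<in> l2 (tuples X N)" using itp_cauchyD_l2[OF \<psi>(1)] .
  let ?f = "\<lambda>n. if n < N then (\<lambda>_. 0) else level_embed \<phi> N (n - N) (\<psi> N)"
  have "itp_dist X \<phi> a (itp_incl X \<phi> N (\<psi> N)) \<le> e / 2"
  proof (rule LIMSEQ_le_const2)
    show "(\<lambda>n. l2_norm (tuples X n) (\<lambda>xs. \<psi> n xs - ?f n xs)) \<longlonglongrightarrow>
        itp_dist X \<phi> a (itp_incl X \<phi> N (\<psi> N))"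
      unfolding itp_incl_def \<psi>(2) by (rule itp_dist_class[OF \<psi>(1) itp_incl_cauchy[OF l]])
    show "\<exists>M. \<forall>n\<ge>M. l2_norm (tuples X n) (\<lambda>xs. \<psi> n xs - ?f n xs) \<le> e / 2"
    proof (intro exI allI impI)
      fix n assume "N \<le> n"
      then show "l2_norm (tuples X n) (\<lambda>xs. \<psi> n xs - ?f n xs) \<le> e / 2"
        using N[of N "n - N"] by simp
    qed
  qed
  then have "itp_dist X \<phi> a (itp_incl X \<phi> N (\<psi> N)) < e" using assms(2) by simp
  then show ?thesis using l by blast
qed

theorem itp_complete:
  assumes a: "\<And>k. a k \<in> itp X \<phi>"
    and cauchy: "\<And>e. e > 0 \<Longrightarrow> \<exists>N. \<forall>m\<ge>N. \<forall>n\<ge>N. itp_dist X \<phi> (a m) (a n) < e"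
  shows "\<exists>b\<in>itp X \<phi>. (\<lambda>k. itp_dist X \<phi> (a k) b) \<longlonglongrightarrow> 0"
proof -
  let ?n = "\<lambda>n. l2_norm (tuples X n)"
  have "\<forall>k. \<exists>\<psi>. \<psi> \<in> itp_cauchy X \<phi> \<and> a k = itp_class X \<phi> \<psi>"
    using itp_cases[OF a] by blast
  then obtain \<psi> where \<psi>: "\<And>k. \<psi> k \<in> itp_cauchy X \<phi>" "\<And>k. a k = itp_class X \<phi> (\<psi> k)" by metis
  note l2 = itp_cauchyD_l2[OF \<psi>(1)]
  have "\<forall>k. \<exists>N. \<forall>m\<ge>N. \<forall>j. ?n (m + j) (\<lambda>xs. \<psi> k (m + j) xs - level_embed \<phi> m j (\<psi> k m) xs) < 1 / (real k + 1)"
  proof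
    fix k
    have "1 / (real k + 1) > 0" by simp
    then show "\<exists>N. \<forall>m\<ge>N. \<forall>j. ?n (m + j) (\<lambda>xs. \<psi> k (m + j) xs - level_embed \<phi> m j (\<psi> k m) xs) < 1 / (real k + 1)"
      using \<psi>(1)[of k] unfolding itp_cauchy_def by blast
  qed
  then obtain N where N: "\<And>k m j. m \<ge> N k \<Longrightarrow>
      ?n (m + j) (\<lambda>xs. \<psi> k (m + j) xs - level_embed \<phi> m j (\<psi> k m) xs) < 1 / (real k + 1)" by metis
  have close: "?n n (\<lambda>xs. \<psi> p n xs - \<psi> q n xs) \<le> itp_dist X \<phi> (a p) (a q) + 1 / (real p + 1) + 1 / (real q + 1)"
    if "N p \<le> n" "N q \<le> n" for p q n
  proof -
    have "?n n (\<lambda>xs. \<psi> p n xs - \<psi> q n xs) - (1 / (real p + 1) + 1 / (real q + 1)) \<le> itp_dist X \<phi> (a p) (a q)"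
    proof (rule LIMSEQ_le_const)
      show "(\<lambda>n. ?n n (\<lambda>xs. \<psi> p n xs - \<psi> q n xs)) \<longlonglongrightarrow> itp_dist X \<phi> (a p) (a q)"
        unfolding \<psi>(2) by (rule itp_dist_class[OF \<psi>(1) \<psi>(1)])
      show "\<exists>M. \<forall>r\<ge>M. ?n n (\<lambda>xs. \<psi> p n xs - \<psi> q n xs) - (1 / (real p + 1) + 1 / (real q + 1)) \<le>
          ?n r (\<lambda>xs. \<psi> p r xs - \<psi> q r xs)"
      proof (intro exI allI impI)
        fix r assume "n \<le> r"
        then obtain j where r: "r = n + j" by (metis le_Suc_ex)
        let ?P = "level_embed \<phi> n j (\<psi> p n)" and ?Q = "level_embed \<phi> n j (\<psi> q n)"
        have e: "?P \<in> l2 (tuples X r)" "?Q \<in> l2 (tuples X r)" unfolding r by (intro level_embed_l2 l2)+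
        have "?n n (\<lambda>xs. \<psi> p n xs - \<psi> q n xs) = ?n r (\<lambda>xs. ?P xs - ?Q xs)"
          unfolding r
          by (simp flip: level_embed_norm[OF l2_diff[OF l2[of p n] l2[of q n]], of j] add: level_embed_diff)
        also have "\<dots> \<le> ?n r (\<lambda>xs. ?P xs - \<psi> p r xs) + ?n r (\<lambda>xs. \<psi> p r xs - ?Q xs)"
          by (rule l2_norm_triangle_diff[OF e(1) l2 e(2)])
        also have "?n r (\<lambda>xs. \<psi> p r xs - ?Q xs) \<le>
            ?n r (\<lambda>xs. \<psi> p r xs - \<psi> q r xs) + ?n r (\<lambda>xs. \<psi> q r xs - ?Q xs)"
          by (rule l2_norm_triangle_diff[OF l2 l2 e(2)])
        finally have "?n n (\<lambda>xs. \<psi> p n xs - \<psi> q n xs) \<le> ?n r (\<lambda>xs. ?P xs - \<psi> p r xs) +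
            (?n r (\<lambda>xs. \<psi> p r xs - \<psi> q r xs) + ?n r (\<lambda>xs. \<psi> q r xs - ?Q xs))" by simp
        moreover have "?n r (\<lambda>xs. ?P xs - \<psi> p r xs) < 1 / (real p + 1)"
          using N[OF that(1), of j] unfolding r by (simp add: l2_norm_minus_commute)
        moreover have "?n r (\<lambda>xs. \<psi> q r xs - ?Q xs) < 1 / (real q + 1)"
          using N[OF that(2), of j] unfolding r by simp
        ultimately show "?n n (\<lambda>xs. \<psi> p n xs - \<psi> q n xs) - (1 / (real p + 1) + 1 / (real q + 1)) \<le>
          ?n r (\<lambda>xs. \<psi> p r xs - \<psi> q r xs)" by linarith
      qed
    qed
    then show ?thesis by linarith
  qed
  define M where "M k = k + (\<Sum>i\<le>k. N i)" for k
  have MN: "N k \<le> M k" for k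
    unfolding M_def by (intro trans_le_add2 member_le_sum) auto
  have Mk: "k \<le> M k" for k by (simp add: M_def)
  define \<kappa> where "\<kappa> n = Max (insert 0 {k. M k \<le> n})" for n
  have fin: "finite {k. M k \<le> n}" for n
    by (rule finite_subset[of _ "{..n}"]) (use Mk le_trans in blast)+
  have \<kappa>_ge: "k \<le> \<kappa> n" if "M k \<le> n" for k n
    unfolding \<kappa>_def using fin that by (intro Max_ge) auto
  have \<kappa>_M: "M (\<kappa> n) \<le> n" if "M 0 \<le> n" for n
  proof -
    have "\<kappa> n \<in> insert 0 {k. M k \<le> n}" unfolding \<kappa>_def using fin by (intro Max_in) auto
    then show ?thesis using that by auto
  qed
  have \<kappa>_N: "N (\<kappa> n) \<le> n" if "M 0 \<le> n" for n
    using \<kappa>_M[OF that] MN le_trans by blast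
  define \<eta> where "\<eta> n = \<psi> (\<kappa> n) n" for n
  have small: "1 / (real k + 1) \<le> 1 / (real K + 1)" if "K \<le> k" for k K
    using that by (simp add: frac_le)
  have ex: "\<exists>K. 1 / (real K + 1) < e" if "e > 0" for e
    using reals_Archimedean[OF that] by (auto simp: inverse_eq_divide add.commute)
  have \<eta>: "\<eta> \<in> itp_cauchy X \<phi>"
    unfolding itp_cauchy_def
  proof (intro CollectI conjI allI impI)
    show "\<eta> n \<in> l2 (tuples X n)" for n unfolding \<eta>_def by (rule l2)
    fix e :: real assume e: "e > 0"
    then have e4: "e / 4 > 0" by simp
    obtain L where L: "\<And>m n. m \<ge> L \<Longrightarrow> n \<ge> L \<Longrightarrow> itp_dist X \<phi> (a m) (a n) < e / 4"
      using cauchy[OF e4] by blast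
    obtain K where K: "1 / (real K + 1) < e / 4" using ex[OF e4] by blast
    show "\<exists>N. \<forall>m\<ge>N. \<forall>k. ?n (m + k) (\<lambda>xs. \<eta> (m + k) xs - level_embed \<phi> m k (\<eta> m) xs) < e"
    proof (intro exI allI impI)
      fix m k assume m: "M 0 + M (max K L) \<le> m"
      let ?p = "\<kappa> (m + k)" and ?q = "\<kappa> m"
      have pq: "max K L \<le> ?p" "max K L \<le> ?q" using m by (auto intro!: \<kappa>_ge simp del: max.bounded_iff)
      have n: "N ?p \<le> m + k" "N ?q \<le> m" "N ?q \<le> m + k"
        using m \<kappa>_N[of m] \<kappa>_N[of "m + k"] by auto
      have "?n (m + k) (\<lambda>xs. \<eta> (m + k) xs - level_embed \<phi> m k (\<eta> m) xs) \<le>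
          ?n (m + k) (\<lambda>xs. \<psi> ?p (m + k) xs - \<psi> ?q (m + k) xs) +
          ?n (m + k) (\<lambda>xs. \<psi> ?q (m + k) xs - level_embed \<phi> m k (\<psi> ?q m) xs)"
        unfolding \<eta>_def by (intro l2_norm_triangle_diff l2 level_embed_l2)
      then show "?n (m + k) (\<lambda>xs. \<eta> (m + k) xs - level_embed \<phi> m k (\<eta> m) xs) < e"
        using close[OF n(1,3)] N[OF n(2), of k] L[of ?p ?q] pq small[of K ?p] small[of K ?q] K by auto
    qed
  qed
  have "(\<lambda>k. itp_dist X \<phi> (a k) (itp_class X \<phi> \<eta>)) \<longlonglongrightarrow> 0"
  proof (rule LIMSEQ_I)
    fix e :: real assume "e > 0"
    then have e4: "e / 4 > 0" by simp
    obtain L where L: "\<And>m n. m \<ge> L \<Longrightarrow> n \<ge> L \<Longrightarrow> itp_dist X \<phi> (a m) (a n) < e / 4"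
      using cauchy[OF e4] by blast
    obtain K where K: "1 / (real K + 1) < e / 4" using ex[OF e4] by blast
    show "\<exists>P. \<forall>k\<ge>P. norm (itp_dist X \<phi> (a k) (itp_class X \<phi> \<eta>) - 0) < e"
    proof (intro exI allI impI)
      fix k assume k: "max K L \<le> k"
      have lim: "(\<lambda>n. ?n n (\<lambda>xs. \<psi> k n xs - \<eta> n xs)) \<longlonglongrightarrow> itp_dist X \<phi> (a k) (itp_class X \<phi> \<eta>)"
        unfolding \<psi>(2) by (rule itp_dist_class[OF \<psi>(1) \<eta>])
      have "itp_dist X \<phi> (a k) (itp_class X \<phi> \<eta>) \<le> 3 * (e / 4)"
      proof (rule LIMSEQ_le_const2[OF lim], intro exI allI impI)
        fix n assume n: "M 0 + M (max K L) + N k \<le> n"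
        then have "max K L \<le> \<kappa> n" by (auto intro!: \<kappa>_ge simp del: max.bounded_iff)
        moreover have "N k \<le> n" "N (\<kappa> n) \<le> n" using n \<kappa>_N[of n] by auto
        ultimately show "?n n (\<lambda>xs. \<psi> k n xs - \<eta> n xs) \<le> 3 * (e / 4)"
          using close[of k n "\<kappa> n"] L[of k "\<kappa> n"] k small[of K k] small[of K "\<kappa> n"] K
          unfolding \<eta>_def by auto
      qed
      moreover have "0 \<le> itp_dist X \<phi> (a k) (itp_class X \<phi> \<eta>)"
        by (rule LIMSEQ_le_const[OF lim]) (auto simp: l2_norm_nonneg)
      ultimately show "norm (itp_dist X \<phi> (a k) (itp_class X \<phi> \<eta>) - 0) < e"
        using \<open>e > 0\<close> by simp
    qed
  qed
  then show ?thesis using itp_class_in[OF \<eta>] by blast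
qed

end


section \<open>Infinite tensor products of operators\<close>

text \<open>\<open>id \<otimes> \<dots> \<otimes> T \<otimes> \<dots> \<otimes> id\<close> with \<open>T\<close> in factor \<open>i\<close>: apply \<open>T\<close> to \<open>\<psi>\<close> as a function of the
  \<open>i\<close>-th coordinate, the other coordinates being fixed.  Levels without a factor \<open>i\<close> are left
  alone; for any given \<open>i\<close> these are finitely many, which does not affect classes.\<close>

definition at_factor ::
    "nat \<Rightarrow> (('a \<Rightarrow> complex) \<Rightarrow> 'a \<Rightarrow> complex) \<Rightarrow> ('a list \<Rightarrow> complex) \<Rightarrow> 'a list \<Rightarrow> complex" where
  "at_factor i T \<psi> = (\<lambda>xs. if i < length xs then T (\<lambda>x. \<psi> (xs[i := x])) (xs ! i) else \<psi> xs)"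

text \<open>For bounded linear operators \<open>T\<^sub>i\<close>, the amplifications to different factors commute, so the order
  of composition is immaterial.\<close>

definition at_factors ::
    "nat set \<Rightarrow> (nat \<Rightarrow> ('a \<Rightarrow> complex) \<Rightarrow> 'a \<Rightarrow> complex) \<Rightarrow> ('a list \<Rightarrow> complex) \<Rightarrow> 'a list \<Rightarrow> complex" where
  "at_factors J T \<psi> = fold (\<lambda>i. at_factor i (T i)) (sorted_list_of_set J) \<psi>"

definition itp_partial_op ::
    "'a set \<Rightarrow> (nat \<Rightarrow> 'a \<Rightarrow> complex) \<Rightarrow>
      (nat \<Rightarrow> ('a \<Rightarrow> complex) \<Rightarrow> 'a \<Rightarrow> complex) \<Rightarrow> nat set \<Rightarrow>
       (nat \<Rightarrow> 'a list \<Rightarrow> complex) set \<Rightarrow> (nat \<Rightarrow> 'a list \<Rightarrow> complex) set" where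
  "itp_partial_op X \<phi> T J a = (\<Union>\<psi>\<in>a. itp_class X \<phi> (\<lambda>n. at_factors J T (\<psi> n)))"

definition itp_bounded_op ::
    "'a set \<Rightarrow> (nat \<Rightarrow> 'a \<Rightarrow> complex) \<Rightarrow>
      ((nat \<Rightarrow> 'a list \<Rightarrow> complex) set \<Rightarrow> (nat \<Rightarrow> 'a list \<Rightarrow> complex) set) \<Rightarrow> bool" where
  "itp_bounded_op X \<phi> S \<longleftrightarrow>
     (\<forall>a\<in>itp X \<phi>. S a \<in> itp X \<phi>) \<and>
     (\<forall>a\<in>itp X \<phi>. \<forall>b\<in>itp X \<phi>. S (itp_add X \<phi> a b) = itp_add X \<phi> (S a) (S b)) \<and>
     (\<forall>c. \<forall>a\<in>itp X \<phi>. S (itp_scale X \<phi> c a) = itp_scale X \<phi> c (S a)) \<and>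
     (\<exists>K. \<forall>a\<in>itp X \<phi>. itp_norm X (S a) \<le> K * itp_norm X a)"

definition tensor_op_exists ::
    "'a set \<Rightarrow> (nat \<Rightarrow> 'a \<Rightarrow> complex) \<Rightarrow> (nat \<Rightarrow> ('a \<Rightarrow> complex) \<Rightarrow> 'a \<Rightarrow> complex) \<Rightarrow> bool" where
  "tensor_op_exists X \<phi> T \<longleftrightarrow>
     (\<exists>S. itp_bounded_op X \<phi> S \<and>
        (\<forall>a\<in>itp X \<phi>. ((\<lambda>J. itp_dist X \<phi> (itp_partial_op X \<phi> T J a) (S a)) \<longlongrightarrow> 0)
           (finite_subsets_at_top UNIV)))"

end

theory Submission
  imports Defs
begin

text \<open>Perturb trivial cocycles by coboundaries close to 1: fix \<open>g \<noteq> 1\<close> in \<open>G\<close>, put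
  \<open>k(x, y) = [x = g] + [y = g] - [xy = g]\<close>, and let \<open>u\<^sub>i = exp(\<i> \<theta>\<^sub>i k)\<close> for real \<open>\<theta>\<^sub>i\<close> with
  absolutely convergent sum 0, the factor \<open>u\<^sub>0\<close> being multiplied by the cocycle \<open>v\<close> to be factored.
  As \<open>k(g, g) = 2\<close>, no \<open>u\<^sub>i\<close> is trivial if the \<open>\<theta>\<^sub>i\<close> are small and \<open>\<theta>\<^sub>0\<close> avoids one value.

  Amenability gives unit vectors \<open>\<phi>\<^sub>i\<close> that are moved by less than \<open>2\<^sup>-\<^sup>i\<close> by the first \<open>i\<close> group
  elements, so \<open>\<Sum>\<^sub>i \<parallel>\<lambda>\<^bsub>u\<^sub>i\<^esub>(x) \<phi>\<^sub>i - \<phi>\<^sub>i\<parallel> < \<infinity>\<close>, and this makes the partial tensor products of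
  isometries converge strongly: on vectors from level \<open>m\<close>, omitting factors \<open>i \<ge> m\<close> costs at
  most the corresponding part of the sum.

  Almost invariant vectors are obtained by contradiction, without the Hahn--Banach theorem.  If there
  are none for a finite symmetric set \<open>F\<close> containing 1, uniform convexity bounds the norm of
  \<open>P = \<Sum>\<^bsub>x\<in>F\<^esub> \<lambda>(x)\<close> on \<open>\<ell>\<^sup>2(G)\<close> by some \<open>q < |F|\<close>.  A Neumann series then yields \<open>h > 0\<close> with
  \<open>P h \<le> s h\<close> and \<open>s < |F|\<close>, and an invariant mean of the gradients of \<open>ln h\<close> excludes this.\<close>

section \<open>Weighted shifts\<close>

text \<open>\<open>regular_rep G u x\<close> has this form, with weight \<open>u (inv y, x)\<close>
  at \<open>y\<close> and left multiplication by \<open>inv x\<close> as the map. The value 0 off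
  \<open>X\<close> matches the extension by zero in \<open>l2\<close>.\<close>

definition weighted_shift ::
    "'a set \<Rightarrow> ('a \<Rightarrow> complex) \<Rightarrow> ('a \<Rightarrow> 'a) \<Rightarrow> ('a \<Rightarrow> complex) \<Rightarrow> 'a \<Rightarrow> complex" where
  "weighted_shift X c \<sigma> f = (\<lambda>x. if x \<in> X then c x * f (\<sigma> x) else 0)"

lemma weighted_shift_add:
  "weighted_shift X c \<sigma> (\<lambda>x. f x + g x) = (\<lambda>x. weighted_shift X c \<sigma> f x + weighted_shift X c \<sigma> g x)"
  by (auto simp: weighted_shift_def algebra_simps)

lemma weighted_shift_diff:
  "weighted_shift X c \<sigma> (\<lambda>x. f x - g x) = (\<lambda>x. weighted_shift X c \<sigma> f x - weighted_shift X c \<sigma> g x)"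
  by (auto simp: weighted_shift_def algebra_simps)

lemma weighted_shift_scale:
  "weighted_shift X c \<sigma> (\<lambda>x. a * f x) = (\<lambda>x. a * weighted_shift X c \<sigma> f x)"
  by (auto simp: weighted_shift_def algebra_simps)

lemma weighted_shift_id: "f \<in> l2 X \<Longrightarrow> weighted_shift X (\<lambda>_. 1) (\<lambda>x. x) f = f"
  by (auto simp: weighted_shift_def l2_def)

lemma weighted_shift_l2:
  assumes "bij_betw \<sigma> X X" "\<And>x. x \<in> X \<Longrightarrow> cmod (c x) = 1" "f \<in> l2 X"
  shows "weighted_shift X c \<sigma> f \<in> l2 X"
proof -
  have "(\<lambda>x. (cmod (f (\<sigma> x)))\<^sup>2) summable_on X"
    using summable_on_reindex_bij_betw[OF assms(1), of "\<lambda>x. (cmod (f x))\<^sup>2"] assms(3) by (simp add: l2_def)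
  then have "(\<lambda>x. (cmod (weighted_shift X c \<sigma> f x))\<^sup>2) summable_on X"
    by (rule summable_on_cong[THEN iffD1, rotated]) (simp add: weighted_shift_def norm_mult assms(2))
  then show ?thesis by (simp add: l2_def weighted_shift_def)
qed

lemma weighted_shift_norm:
  assumes "bij_betw \<sigma> X X" "\<And>x. x \<in> X \<Longrightarrow> cmod (c x) = 1"
  shows "l2_norm X (weighted_shift X c \<sigma> f) = l2_norm X f"
proof -
  have "(\<Sum>\<^sub>\<infinity>x\<in>X. (cmod (weighted_shift X c \<sigma> f x))\<^sup>2) = (\<Sum>\<^sub>\<infinity>x\<in>X. (cmod (f (\<sigma> x)))\<^sup>2)"
    by (intro infsum_cong) (simp add: weighted_shift_def norm_mult assms(2))
  also have "\<dots> = (\<Sum>\<^sub>\<infinity>x\<in>X. (cmod (f x))\<^sup>2)"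
    by (rule infsum_reindex_bij_betw[OF assms(1)])
  finally show ?thesis by (simp add: l2_norm_def)
qed


section \<open>Tensor products of weighted shifts\<close>

definition tuple_map :: "(nat \<Rightarrow> 'a \<Rightarrow> 'a) \<Rightarrow> 'a list \<Rightarrow> 'a list" where
  "tuple_map \<sigma> xs = map (\<lambda>i. \<sigma> i (xs ! i)) [0..<length xs]"

definition tuple_weight :: "(nat \<Rightarrow> 'a \<Rightarrow> complex) \<Rightarrow> 'a list \<Rightarrow> complex" where
  "tuple_weight c xs = (\<Prod>i<length xs. c i (xs ! i))"

text \<open>Tensoring weighted shifts multiplies the weights and applies the maps coordinatewise, so
  the product is a single weighted shift on tuples and is isometric for the same reason as its
  factors.\<close>

definition tensor_shift ::
    "'a set \<Rightarrow> (nat \<Rightarrow> 'a \<Rightarrow> complex) \<Rightarrow> (nat \<Rightarrow> 'a \<Rightarrow> 'a) \<Rightarrow> nat \<Rightarrow> ('a list \<Rightarrow> complex) \<Rightarrow> 'a list \<Rightarrow> complex" where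
  "tensor_shift X c \<sigma> n = weighted_shift (tuples X n) (tuple_weight c) (tuple_map \<sigma>)"

text \<open>With identity factors outside \<open>J\<close>, a partial product over \<open>J\<close>
  becomes a full product, and every estimate for full products applies to it.\<close>

definition unit_off :: "nat set \<Rightarrow> (nat \<Rightarrow> 'a \<Rightarrow> complex) \<Rightarrow> nat \<Rightarrow> 'a \<Rightarrow> complex" where
  "unit_off J c i = (if i \<in> J then c i else (\<lambda>_. 1))"

definition id_off :: "nat set \<Rightarrow> (nat \<Rightarrow> 'a \<Rightarrow> 'a) \<Rightarrow> nat \<Rightarrow> 'a \<Rightarrow> 'a" where
  "id_off J \<sigma> i = (if i \<in> J then \<sigma> i else (\<lambda>x. x))"

lemma tuples_iff: "xs \<in> tuples X n \<longleftrightarrow> length xs = n \<and> (\<forall>i<n. xs ! i \<in> X)"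
  by (auto simp: tuples_def set_conv_nth)

lemma length_tuple_map [simp]: "length (tuple_map \<sigma> xs) = length xs"
  by (simp add: tuple_map_def)

lemma nth_tuple_map [simp]: "i < length xs \<Longrightarrow> tuple_map \<sigma> xs ! i = \<sigma> i (xs ! i)"
  by (simp add: tuple_map_def)

lemma tuple_map_snoc: "tuple_map \<sigma> (xs @ [x]) = tuple_map \<sigma> xs @ [\<sigma> (length xs) x]"
  by (rule nth_equalityI) (auto simp: nth_append less_Suc_eq)

lemma tuple_weight_snoc: "tuple_weight c (xs @ [x]) = tuple_weight c xs * c (length xs) x"
  by (auto simp: tuple_weight_def nth_append intro!: prod.cong)

lemma bij_betw_tuple_map:
  assumes "\<And>i. bij_betw (\<sigma> i) X X"
  shows "bij_betw (tuple_map \<sigma>) (tuples X n) (tuples X n)"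
proof -
  let ?\<tau> = "\<lambda>i. inv_into X (\<sigma> i)"
  have s: "\<sigma> i x \<in> X" "?\<tau> i x \<in> X" "?\<tau> i (\<sigma> i x) = x" "\<sigma> i (?\<tau> i x) = x" if "x \<in> X" for i x
    using assms[of i] that
    by (auto simp: bij_betw_def f_inv_into_f intro: inv_into_into)
  show ?thesis
    by (rule bij_betw_byWitness[where f' = "tuple_map ?\<tau>"])
      (auto simp: tuples_iff s intro!: nth_equalityI)
qed

lemma cmod_tuple_weight:
  assumes "\<And>i x. x \<in> X \<Longrightarrow> cmod (c i x) = 1" "xs \<in> tuples X n"
  shows "cmod (tuple_weight c xs) = 1"
  using assms by (auto simp: tuple_weight_def tuples_iff simp flip: prod_norm)

lemma tensor_shift_snoc:
  assumes "\<psi> \<in> l2 (tuples X n)" "f \<in> l2 X"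
  shows "tensor_shift X c \<sigma> (Suc n) (snoc_tensor \<psi> f) =
    snoc_tensor (tensor_shift X c \<sigma> n \<psi>) (weighted_shift X (c n) (\<sigma> n) f)"
proof
  fix xs
  show "tensor_shift X c \<sigma> (Suc n) (snoc_tensor \<psi> f) xs =
    snoc_tensor (tensor_shift X c \<sigma> n \<psi>) (weighted_shift X (c n) (\<sigma> n) f) xs"
  proof (cases xs rule: rev_cases)
    case (snoc ys y)
    then show ?thesis
      by (auto simp: tensor_shift_def weighted_shift_def snoc_tensor_def tuple_map_snoc
          tuple_weight_snoc tuples_def)
  qed (simp add: tensor_shift_def weighted_shift_def snoc_tensor_def tuples_def)
qed

text \<open>Induction on the operator applied last. It replaces coordinate \<open>i\<close> by its
  image under \<open>\<sigma> i\<close> before the inner shift reads the tuple, and the inner shift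
  leaves that coordinate alone because \<open>js\<close> is distinct.\<close>

lemma fold_at_factor:
  assumes "\<And>i. bij_betw (\<sigma> i) X X" "\<psi> \<in> l2 (tuples X n)" "distinct js"
  shows "fold (\<lambda>i. at_factor i (weighted_shift X (c i) (\<sigma> i))) js \<psi> =
    tensor_shift X (unit_off (set js) c) (id_off (set js) \<sigma>) n \<psi>"
  using assms(3)
proof (induction js rule: rev_induct)
  case Nil
  have "tuple_map (id_off {} \<sigma>) xs = xs" for xs
    by (rule nth_equalityI) (auto simp: id_off_def)
  then show ?case
    using assms(2) by (auto simp: tensor_shift_def weighted_shift_def tuple_weight_def unit_off_def l2_def)
next
  case (snoc i js)
  let ?J = "set js"
  from snoc.prems have i: "i \<notin> ?J" by simp
  have eq: "fold (\<lambda>i. at_factor i (weighted_shift X (c i) (\<sigma> i))) (js @ [i]) \<psi> =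
      at_factor i (weighted_shift X (c i) (\<sigma> i)) (tensor_shift X (unit_off ?J c) (id_off ?J \<sigma>) n \<psi>)"
    using snoc by simp
  show ?case
  proof
    fix xs
    let ?c = "unit_off ?J c" and ?c' = "unit_off (insert i ?J) c"
    let ?s = "id_off ?J \<sigma>" and ?s' = "id_off (insert i ?J) \<sigma>"
    let ?ys = "xs[i := \<sigma> i (xs ! i)]"
    show "fold (\<lambda>i. at_factor i (weighted_shift X (c i) (\<sigma> i))) (js @ [i]) \<psi> xs =
      tensor_shift X (unit_off (set (js @ [i])) c) (id_off (set (js @ [i])) \<sigma>) n \<psi> xs"
    proof (cases "i < length xs")
      case True
      have sX: "x \<in> X \<Longrightarrow> \<sigma> i x \<in> X" for x using assms(1)[of i] by (auto simp: bij_betw_def)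
      have 1: "xs ! i \<in> X \<and> ?ys \<in> tuples X n \<longleftrightarrow> xs \<in> tuples X n"
        using True sX by (auto simp: tuples_iff nth_list_update)
      have 2: "tuple_map ?s ?ys = tuple_map ?s' xs"
        using i True by (intro nth_equalityI) (auto simp: id_off_def nth_list_update)
      \<comment> \<open>As \<open>i\<close> is not in \<open>?J\<close>, factor \<open>i\<close> of
        the inner weight is 1, and \<open>c i (xs ! i)\<close> takes its place.\<close>
      have "c i (xs ! i) * tuple_weight ?c ?ys =
          c i (xs ! i) * (?c i (?ys ! i) * (\<Prod>j\<in>{..<length xs} - {i}. ?c j (?ys ! j)))"
        using True by (simp add: tuple_weight_def prod.remove[of "{..<length xs}" i])
      also have "\<dots> = ?c' i (xs ! i) * (\<Prod>j\<in>{..<length xs} - {i}. ?c' j (xs ! j))"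
        using i by (auto simp: unit_off_def intro!: prod.cong)
      also have "\<dots> = tuple_weight ?c' xs"
        using True by (simp add: tuple_weight_def prod.remove[of "{..<length xs}" i])
      finally have 3: "c i (xs ! i) * tuple_weight ?c ?ys = tuple_weight ?c' xs" .
      show ?thesis
        unfolding eq using True 1 2 3
        by (auto simp: at_factor_def tensor_shift_def weighted_shift_def simp flip: mult.assoc)
    next
      case False
      \<comment> \<open>A tuple too short to have a coordinate \<open>i\<close> notices neither the
        operator at factor \<open>i\<close> nor the enlargement of \<open>?J\<close>.\<close>
      have "tuple_map ?s xs = tuple_map ?s' xs"
        using False by (intro nth_equalityI) (auto simp: id_off_def)
      moreover have "tuple_weight ?c xs = tuple_weight ?c' xs"
        unfolding tuple_weight_def using False by (intro prod.cong) (auto simp: unit_off_def)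
      ultimately show ?thesis
        unfolding eq using False by (simp add: at_factor_def tensor_shift_def weighted_shift_def)
    qed
  qed
qed

lemma at_factors_weighted_shift:
  assumes "\<And>i. bij_betw (\<sigma> i) X X" "\<psi> \<in> l2 (tuples X n)" "finite J"
  shows "at_factors J (\<lambda>i. weighted_shift X (c i) (\<sigma> i)) \<psi> =
    tensor_shift X (unit_off J c) (id_off J \<sigma>) n \<psi>"
  unfolding at_factors_def using fold_at_factor[OF assms(1,2), of "sorted_list_of_set J" c] assms(3)
  by simp

section \<open>Weighted shifts on the completed infinite tensor product\<close>

locale unit_vectors =
  fixes X :: "'a set" and \<phi> :: "nat \<Rightarrow> 'a \<Rightarrow> complex"
  assumes unit: "\<And>i. \<phi> i \<in> l2 X" "\<And>i. l2_norm X (\<phi> i) = 1"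
begin

lemmas level_embed_l2 = level_embed_l2[where X = X and \<phi> = \<phi>, OF unit]
lemmas level_embed_norm = level_embed_norm[where X = X and \<phi> = \<phi>, OF unit]
lemmas itp_cauchyD_l2 = itp_cauchyD_l2[where X = X and \<phi> = \<phi>, OF unit]
lemmas itp_cauchyD = itp_cauchyD[where X = X and \<phi> = \<phi>, OF unit]
lemmas itp_cauchy_add = itp_cauchy_add[where X = X and \<phi> = \<phi>, OF unit]
lemmas itp_cauchy_scale = itp_cauchy_scale[where X = X and \<phi> = \<phi>, OF unit]
lemmas itp_cauchy_norm_convergent = itp_cauchy_norm_convergent[where X = X and \<phi> = \<phi>, OF unit]
lemmas equiv_itp_rel = equiv_itp_rel[where X = X and \<phi> = \<phi>, OF unit]
lemmas itp_class_in = itp_class_in[where X = X and \<phi> = \<phi>, OF unit]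
lemmas itp_cases = itp_cases[where X = X and \<phi> = \<phi>, OF unit]
lemmas itp_class_eq_iff = itp_class_eq_iff[where X = X and \<phi> = \<phi>, OF unit]
lemmas itp_add_class = itp_add_class[where X = X and \<phi> = \<phi>, OF unit]
lemmas itp_scale_class = itp_scale_class[where X = X and \<phi> = \<phi>, OF unit]
lemmas itp_norm_class = itp_norm_class[where X = X and \<phi> = \<phi>, OF unit]
lemmas itp_dist_class = itp_dist_class[where X = X and \<phi> = \<phi>, OF unit]

lemma itp_cauchy_norm_bounded:
  assumes "\<psi> \<in> itp_cauchy X \<phi>"
  obtains B where "B > 0" "\<And>n. l2_norm (tuples X n) (\<psi> n) \<le> B"
proof -
  have "Bseq (\<lambda>n. l2_norm (tuples X n) (\<psi> n))"
    by (intro convergent_imp_Bseq itp_cauchy_norm_convergent[OF assms])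
  then show ?thesis using that by (elim BseqE) (auto simp: abs_le_iff)
qed

end

locale shift_family = unit_vectors +
  fixes c :: "nat \<Rightarrow> 'a \<Rightarrow> complex" and \<sigma> :: "nat \<Rightarrow> 'a \<Rightarrow> 'a"
  assumes bij: "\<And>i. bij_betw (\<sigma> i) X X"
    and unimodular: "\<And>i x. x \<in> X \<Longrightarrow> cmod (c i x) = 1"
begin

lemma tensor_shift_l2: "\<psi> \<in> l2 (tuples X n) \<Longrightarrow> tensor_shift X c \<sigma> n \<psi> \<in> l2 (tuples X n)"
  unfolding tensor_shift_def
  by (rule weighted_shift_l2[OF bij_betw_tuple_map[OF bij] cmod_tuple_weight[OF unimodular]])

lemma tensor_shift_norm: "l2_norm (tuples X n) (tensor_shift X c \<sigma> n \<psi>) = l2_norm (tuples X n) \<psi>"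
  unfolding tensor_shift_def
  by (rule weighted_shift_norm[OF bij_betw_tuple_map[OF bij] cmod_tuple_weight[OF unimodular]])

lemma tensor_shift_diff_norm:
  "l2_norm (tuples X n) (\<lambda>xs. tensor_shift X c \<sigma> n \<psi> xs - tensor_shift X c \<sigma> n \<eta> xs) =
    l2_norm (tuples X n) (\<lambda>xs. \<psi> xs - \<eta> xs)"
  using tensor_shift_norm[of n "\<lambda>xs. \<psi> xs - \<eta> xs"]
  by (simp add: tensor_shift_def weighted_shift_diff)

text \<open>Each further unit vector costs one term:
  \<open>A \<otimes> f - B \<otimes> \<phi>\<close> is
  \<open>A \<otimes> (f - \<phi>) + (A - B) \<otimes> \<phi>\<close>, norms of tensors multiply, and
  \<open>A\<close> has the norm of \<open>\<psi>\<close> because shifts and embeddings are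
  isometric.\<close>

lemma tensor_shift_level_embed:
  assumes \<psi>: "\<psi> \<in> l2 (tuples X m)"
  shows "l2_norm (tuples X (m + k)) (\<lambda>xs. tensor_shift X c \<sigma> (m + k) (level_embed \<phi> m k \<psi>) xs -
      level_embed \<phi> m k (tensor_shift X c \<sigma> m \<psi>) xs) \<le>
    l2_norm (tuples X m) \<psi> *
      (\<Sum>i = m..<m + k. l2_norm X (\<lambda>x. weighted_shift X (c i) (\<sigma> i) (\<phi> i) x - \<phi> i x))"
proof (induction k)
  case 0
  then show ?case by (simp add: l2_norm_zero)
next
  case (Suc k)
  let ?E = "level_embed \<phi> m k \<psi>" and ?n = "m + k"
  let ?A = "tensor_shift X c \<sigma> ?n ?E" and ?B = "level_embed \<phi> m k (tensor_shift X c \<sigma> m \<psi>)"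
  let ?f = "weighted_shift X (c ?n) (\<sigma> ?n) (\<phi> ?n)"
  have l2: "?E \<in> l2 (tuples X ?n)" "?A \<in> l2 (tuples X ?n)" "?B \<in> l2 (tuples X ?n)" "?f \<in> l2 X"
    using \<psi> unit by (auto intro!: level_embed_l2 tensor_shift_l2 weighted_shift_l2 bij unimodular)
  have d: "(\<lambda>x. ?f x - \<phi> ?n x) \<in> l2 X" "(\<lambda>xs. ?A xs - ?B xs) \<in> l2 (tuples X ?n)"
    using l2 unit by (auto intro!: l2_diff)
  have "l2_norm (tuples X (Suc ?n)) (\<lambda>xs. snoc_tensor ?A ?f xs - snoc_tensor ?B (\<phi> ?n) xs) =
    l2_norm (tuples X (Suc ?n)) (\<lambda>xs. snoc_tensor ?A (\<lambda>x. ?f x - \<phi> ?n x) xs +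
      snoc_tensor (\<lambda>xs. ?A xs - ?B xs) (\<phi> ?n) xs)"
    by (intro arg_cong[where f = "l2_norm _"]) (auto simp: snoc_tensor_def algebra_simps)
  also have "\<dots> \<le> l2_norm (tuples X (Suc ?n)) (snoc_tensor ?A (\<lambda>x. ?f x - \<phi> ?n x)) +
      l2_norm (tuples X (Suc ?n)) (snoc_tensor (\<lambda>xs. ?A xs - ?B xs) (\<phi> ?n))"
    using l2 d unit by (intro l2_norm_triangle snoc_tensor_l2)
  also have "\<dots> = l2_norm (tuples X m) \<psi> * l2_norm X (\<lambda>x. ?f x - \<phi> ?n x) +
      l2_norm (tuples X ?n) (\<lambda>xs. ?A xs - ?B xs)"
    using l2 d unit \<psi> by (simp add: snoc_tensor_norm tensor_shift_norm level_embed_norm)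
  finally show ?case
    using Suc.IH l2(1) unit by (simp add: tensor_shift_snoc algebra_simps)
qed

text \<open>The shift is isometric, so replacing \<open>\<psi>\<close> by the embedded
  \<open>\<eta>\<close> costs only their distance; \<open>tensor_shift_level_embed\<close> does the
  rest.\<close>

lemma tensor_shift_near_level:
  assumes "\<psi> \<in> l2 (tuples X (m + k))" "\<eta> \<in> l2 (tuples X m)"
  shows "l2_norm (tuples X (m + k)) (\<lambda>xs. tensor_shift X c \<sigma> (m + k) \<psi> xs -
      level_embed \<phi> m k (tensor_shift X c \<sigma> m \<eta>) xs) \<le>
    l2_norm (tuples X (m + k)) (\<lambda>xs. \<psi> xs - level_embed \<phi> m k \<eta> xs) + l2_norm (tuples X m) \<eta> *
      (\<Sum>i = m..<m + k. l2_norm X (\<lambda>x. weighted_shift X (c i) (\<sigma> i) (\<phi> i) x - \<phi> i x))"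
proof -
  have E: "level_embed \<phi> m k \<eta> \<in> l2 (tuples X (m + k))"
    by (rule level_embed_l2[OF assms(2)])
  show ?thesis
    using l2_norm_triangle_diff[OF tensor_shift_l2[OF assms(1)] tensor_shift_l2[OF E]
        level_embed_l2[OF tensor_shift_l2[OF assms(2)], of k]]
      tensor_shift_level_embed[OF assms(2), of k] tensor_shift_diff_norm[of "m + k" \<psi> "level_embed \<phi> m k \<eta>"]
    by linarith
qed

context
  assumes summable: "summable (\<lambda>i. l2_norm X (\<lambda>x. weighted_shift X (c i) (\<sigma> i) (\<phi> i) x - \<phi> i x))"
begin

text \<open>This is the Cauchy condition of \<open>itp_cauchy\<close> for the shifted sequence. Half
  of \<open>e\<close> is spent on the Cauchy property of \<open>\<psi>\<close>, half on a tail of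
  the series times the norm bound \<open>B\<close>.\<close>

lemma tensor_shift_near_level_eventually:
  assumes "\<psi> \<in> itp_cauchy X \<phi>" "e > 0"
  shows "\<exists>N. \<forall>m\<ge>N. \<forall>k. l2_norm (tuples X (m + k)) (\<lambda>xs. tensor_shift X c \<sigma> (m + k) (\<psi> (m + k)) xs -
      level_embed \<phi> m k (tensor_shift X c \<sigma> m (\<psi> m)) xs) < e"
proof -
  let ?\<delta> = "\<lambda>i. l2_norm X (\<lambda>x. weighted_shift X (c i) (\<sigma> i) (\<phi> i) x - \<phi> i x)"
  obtain B where B: "B > 0" "\<And>n. l2_norm (tuples X n) (\<psi> n) \<le> B"
    by (rule itp_cauchy_norm_bounded[OF assms(1)]) blast
  have "e / 2 > 0" "e / (2 * B) > 0" using assms(2) B by auto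
  obtain M where M: "\<And>m k. m \<ge> M \<Longrightarrow>
      l2_norm (tuples X (m + k)) (\<lambda>xs. \<psi> (m + k) xs - level_embed \<phi> m k (\<psi> m) xs) < e / 2"
    by (rule itp_cauchyD[OF assms(1) \<open>e / 2 > 0\<close>]) blast
  obtain N where N: "\<And>m n. m \<ge> N \<Longrightarrow> norm (\<Sum>i = m..<n. ?\<delta> i) < e / (2 * B)"
    using summable \<open>e / (2 * B) > 0\<close> unfolding summable_Cauchy by blast
  show ?thesis
  proof (intro exI allI impI)
    fix m k assume m: "max M N \<le> m"
    have "l2_norm (tuples X m) (\<psi> m) * (\<Sum>i = m..<m + k. ?\<delta> i) \<le> B * (e / (2 * B))"
      using B N[of m "m + k"] m by (intro mult_mono) (auto simp: sum_nonneg l2_norm_nonneg)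
    also have "\<dots> = e / 2" using B by simp
    finally show "l2_norm (tuples X (m + k)) (\<lambda>xs. tensor_shift X c \<sigma> (m + k) (\<psi> (m + k)) xs -
      level_embed \<phi> m k (tensor_shift X c \<sigma> m (\<psi> m)) xs) < e"
      using tensor_shift_near_level[where m = m and k = k, OF itp_cauchyD_l2[OF assms(1)] itp_cauchyD_l2[OF assms(1)]]
        M[of m k] m by auto
  qed
qed

lemma tensor_shift_cauchy:
  assumes "\<psi> \<in> itp_cauchy X \<phi>"
  shows "(\<lambda>n. tensor_shift X c \<sigma> n (\<psi> n)) \<in> itp_cauchy X \<phi>"
  unfolding itp_cauchy_def
  using tensor_shift_near_level_eventually[OF assms] tensor_shift_l2[OF itp_cauchyD_l2[OF assms]]
  by blast

text \<open>On each level the shift preserves norms of differences, hence it respects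
  \<open>itp_rel\<close>, and the union over all representatives collapses to one class.\<close>

lemma tensor_shift_class:
  assumes "\<psi> \<in> itp_cauchy X \<phi>"
  shows "(\<Union>\<eta>\<in>itp_class X \<phi> \<psi>. itp_class X \<phi> (\<lambda>n. tensor_shift X c \<sigma> n (\<eta> n))) =
    itp_class X \<phi> (\<lambda>n. tensor_shift X c \<sigma> n (\<psi> n))"
  unfolding itp_class_def[of X \<phi> \<psi>]
proof (rule UN_equiv_class[OF equiv_itp_rel _ assms], rule congruentI)
  fix \<psi> \<eta> assume r: "(\<psi>, \<eta>) \<in> itp_rel X \<phi>"
  then have "\<psi> \<in> itp_cauchy X \<phi>" "\<eta> \<in> itp_cauchy X \<phi>" by (auto simp: itp_rel_def)
  then show "itp_class X \<phi> (\<lambda>n. tensor_shift X c \<sigma> n (\<psi> n)) = itp_class X \<phi> (\<lambda>n. tensor_shift X c \<sigma> n (\<eta> n))"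
    using r by (subst itp_class_eq_iff)
      (auto simp: itp_rel_def tensor_shift_diff_norm intro: tensor_shift_cauchy)
qed

lemma itp_bounded_op_tensor_shift:
  "itp_bounded_op X \<phi> (\<lambda>a. \<Union>\<psi>\<in>a. itp_class X \<phi> (\<lambda>n. tensor_shift X c \<sigma> n (\<psi> n)))" (is "itp_bounded_op X \<phi> ?S")
  unfolding itp_bounded_op_def
proof (intro conjI allI ballI)
  fix a assume "a \<in> itp X \<phi>"
  then show "?S a \<in> itp X \<phi>"
    by (elim itp_cases) (simp add: tensor_shift_class itp_class_in tensor_shift_cauchy)
next
  fix a b assume "a \<in> itp X \<phi>" "b \<in> itp X \<phi>"
  then obtain \<psi> \<eta> where c: "\<psi> \<in> itp_cauchy X \<phi>" "\<eta> \<in> itp_cauchy X \<phi>"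
    and ab: "a = itp_class X \<phi> \<psi>" "b = itp_class X \<phi> \<eta>"
    by (elim itp_cases)
  show "?S (itp_add X \<phi> a b) = itp_add X \<phi> (?S a) (?S b)"
    using c by (simp add: ab itp_add_class tensor_shift_class itp_cauchy_add tensor_shift_cauchy)
      (simp add: tensor_shift_def weighted_shift_add)
next
  fix z a assume "a \<in> itp X \<phi>"
  then obtain \<psi> where c: "\<psi> \<in> itp_cauchy X \<phi>" and a: "a = itp_class X \<phi> \<psi>"
    by (elim itp_cases)
  show "?S (itp_scale X \<phi> z a) = itp_scale X \<phi> z (?S a)"
    using c by (simp add: a itp_scale_class tensor_shift_class itp_cauchy_scale tensor_shift_cauchy)
      (simp add: tensor_shift_def weighted_shift_scale)
next
  show "\<exists>K. \<forall>a\<in>itp X \<phi>. itp_norm X (?S a) \<le> K * itp_norm X a"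
  proof (intro exI ballI)
    fix a assume "a \<in> itp X \<phi>"
    then obtain \<psi> where c: "\<psi> \<in> itp_cauchy X \<phi>" and a: "a = itp_class X \<phi> \<psi>"
      by (elim itp_cases)
    \<comment> \<open>The norms on the levels are unchanged, hence so is their limit, and
      \<open>K\<close> can be 1.\<close>
    have "itp_norm X (?S a) = itp_norm X a"
      using LIMSEQ_unique[OF itp_norm_class[OF c] itp_norm_class[OF tensor_shift_cauchy[OF c],
            unfolded tensor_shift_norm]]
      by (simp add: a tensor_shift_class[OF c])
    then show "itp_norm X (?S a) \<le> 1 * itp_norm X a" by simp
  qed
qed

end

end

section \<open>Strong convergence of the partial tensor products\<close>

lemma bij_betw_id_off: "(\<And>i. bij_betw (\<sigma> i) X X) \<Longrightarrow> bij_betw (id_off J \<sigma> i) X X"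
  using bij_betw_id[of X] by (simp add: id_off_def id_def)

lemma cmod_unit_off: "(\<And>i x. x \<in> X \<Longrightarrow> cmod (c i x) = 1) \<Longrightarrow> x \<in> X \<Longrightarrow> cmod (unit_off J c i x) = 1"
  by (simp add: unit_off_def)

text \<open>Level \<open>n\<close> involves only the factors below \<open>n\<close>, so a
  \<open>J\<close> containing all of these acts there like the set of all indices.\<close>

lemma tensor_shift_off:
  assumes "{..<n} \<subseteq> J"
  shows "tensor_shift X (unit_off J c) (id_off J \<sigma>) n = tensor_shift X c \<sigma> n"
proof -
  have "tuple_map (id_off J \<sigma>) xs = tuple_map \<sigma> xs" "tuple_weight (unit_off J c) xs = tuple_weight c xs"
    if "length xs = n" for xs
    using assms that
    by (auto simp: id_off_def unit_off_def tuple_weight_def intro!: nth_equalityI prod.cong)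
  then show ?thesis
    unfolding tensor_shift_def weighted_shift_def by (intro ext) (simp add: tuples_def)
qed

text \<open>For \<open>J\<close> containing \<open>{..<N}\<close>, partial and full product agree on
  level \<open>N\<close>. On higher levels both stay near the embedding of this common vector,
  uniformly in \<open>J\<close>, because a factor outside \<open>J\<close> contributes 0 instead of
  its term of the series.\<close>

theorem (in shift_family) tensor_op_exists_weighted_shift:
  assumes summable: "summable (\<lambda>i. l2_norm X (\<lambda>x. weighted_shift X (c i) (\<sigma> i) (\<phi> i) x - \<phi> i x))"
  shows "tensor_op_exists X \<phi> (\<lambda>i. weighted_shift X (c i) (\<sigma> i))"
proof -
  let ?\<delta> = "\<lambda>i. l2_norm X (\<lambda>x. weighted_shift X (c i) (\<sigma> i) (\<phi> i) x - \<phi> i x)"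
  let ?W = "tensor_shift X c \<sigma>"
  let ?V = "\<lambda>J. tensor_shift X (unit_off J c) (id_off J \<sigma>)"
  let ?S = "\<lambda>a. \<Union>\<psi>\<in>a. itp_class X \<phi> (\<lambda>n. ?W n (\<psi> n))"
  interpret V: shift_family X \<phi> "unit_off J c" "id_off J \<sigma>" for J
    by unfold_locales (auto simp: unit bij_betw_id_off[OF bij] cmod_unit_off[OF unimodular])
  have \<delta>J: "l2_norm X (\<lambda>x. weighted_shift X (unit_off J c i) (id_off J \<sigma> i) (\<phi> i) x - \<phi> i x) \<le> ?\<delta> i" for J i
    using unit(1)[of i] by (auto simp: unit_off_def id_off_def weighted_shift_id l2_norm_zero l2_norm_nonneg)
  have summableJ: "summable (\<lambda>i. l2_norm X (\<lambda>x. weighted_shift X (unit_off J c i) (id_off J \<sigma> i) (\<phi> i) x - \<phi> i x))" for J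
    using summable by (rule summable_comparison_test') (simp add: \<delta>J l2_norm_nonneg)
  have partial: "itp_partial_op X \<phi> (\<lambda>i. weighted_shift X (c i) (\<sigma> i)) J (itp_class X \<phi> \<psi>) =
      itp_class X \<phi> (\<lambda>n. ?V J n (\<psi> n))" if "\<psi> \<in> itp_cauchy X \<phi>" "finite J" for J \<psi>
  proof -
    have "at_factors J (\<lambda>i. weighted_shift X (c i) (\<sigma> i)) (\<eta> n) = ?V J n (\<eta> n)"
      if "\<eta> \<in> itp_class X \<phi> \<psi>" for \<eta> n
      using that \<open>finite J\<close> itp_cauchyD_l2
      by (intro at_factors_weighted_shift bij) (auto simp: itp_class_def itp_rel_def)
    then show ?thesis
      unfolding itp_partial_op_def using V.tensor_shift_class[OF summableJ that(1)] by simp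
  qed
  have conv: "((\<lambda>J. itp_dist X \<phi> (itp_partial_op X \<phi> (\<lambda>i. weighted_shift X (c i) (\<sigma> i)) J a) (?S a)) \<longlongrightarrow> 0)
      (finite_subsets_at_top UNIV)" if a: "a \<in> itp X \<phi>" for a
  proof (rule tendstoI)
    fix e :: real assume "e > 0"
    obtain \<psi> where \<psi>: "\<psi> \<in> itp_cauchy X \<phi>" "a = itp_class X \<phi> \<psi>"
      by (rule itp_cases[OF a])
    note l2 = itp_cauchyD_l2[OF \<psi>(1)]
    obtain B where B: "B > 0" "\<And>n. l2_norm (tuples X n) (\<psi> n) \<le> B"
      by (rule itp_cauchy_norm_bounded[OF \<psi>(1)]) blast
    \<comment> \<open>Two errors of \<open>e / 8\<close> make up \<open>near\<close>, and two uses
      of \<open>near\<close> give \<open>e / 2\<close>, strictly below \<open>e\<close>.\<close>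
    have "e / (8 * B) > 0" "e / 8 > 0" using \<open>e > 0\<close> B by auto
    obtain M where M: "\<And>m k. m \<ge> M \<Longrightarrow>
        l2_norm (tuples X (m + k)) (\<lambda>xs. \<psi> (m + k) xs - level_embed \<phi> m k (\<psi> m) xs) < e / 8"
      by (rule itp_cauchyD[OF \<psi>(1) \<open>e / 8 > 0\<close>]) blast
    obtain L where L: "\<And>m n. m \<ge> L \<Longrightarrow> norm (\<Sum>i = m..<n. ?\<delta> i) < e / (8 * B)"
      using summable \<open>e / (8 * B) > 0\<close> unfolding summable_Cauchy by blast
    define N where "N = max M L"
    have near: "l2_norm (tuples X (N + k)) (\<lambda>xs. ?V J (N + k) (\<psi> (N + k)) xs - level_embed \<phi> N k (?V J N (\<psi> N)) xs) \<le> e / 4"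
      for J k
    proof -
      have "l2_norm (tuples X N) (\<psi> N) * (\<Sum>i = N..<N + k.
          l2_norm X (\<lambda>x. weighted_shift X (unit_off J c i) (id_off J \<sigma> i) (\<phi> i) x - \<phi> i x)) \<le>
          B * (\<Sum>i = N..<N + k. ?\<delta> i)"
        using B by (intro mult_mono sum_mono \<delta>J) (auto simp: sum_nonneg l2_norm_nonneg)
      also have "\<dots> \<le> B * (e / (8 * B))"
        using B L[of N "N + k"] by (intro mult_left_mono) (auto simp: N_def)
      also have "\<dots> = e / 8" using B by simp
      finally show ?thesis
        using V.tensor_shift_near_level[of "\<psi> (N + k)" N k "\<psi> N" J, OF l2 l2] M[of N k] by (auto simp: N_def)
    qed
    have "itp_dist X \<phi> (itp_partial_op X \<phi> (\<lambda>i. weighted_shift X (c i) (\<sigma> i)) J a) (?S a) \<in> {0..e / 2}"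
      if J: "finite J" "{..<N} \<subseteq> J" for J
    proof -
      have lim: "(\<lambda>n. l2_norm (tuples X n) (\<lambda>xs. ?V J n (\<psi> n) xs - ?W n (\<psi> n) xs)) \<longlonglongrightarrow>
          itp_dist X \<phi> (itp_partial_op X \<phi> (\<lambda>i. weighted_shift X (c i) (\<sigma> i)) J a) (?S a)"
        unfolding \<psi>(2) partial[OF \<psi>(1) J(1)] tensor_shift_class[OF summable \<psi>(1)]
        by (rule itp_dist_class[OF V.tensor_shift_cauchy[OF summableJ \<psi>(1)]
              tensor_shift_cauchy[OF summable \<psi>(1)]])
      have "l2_norm (tuples X n) (\<lambda>xs. ?V J n (\<psi> n) xs - ?W n (\<psi> n) xs) \<le> e / 2" if N: "N \<le> n" for n
      proof -
        obtain k where n: "n = N + k" using N le_Suc_ex by blast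
        let ?E = "level_embed \<phi> N k (?W N (\<psi> N))"
        have "l2_norm (tuples X n) (\<lambda>xs. ?V J n (\<psi> n) xs - ?W n (\<psi> n) xs) \<le>
          l2_norm (tuples X n) (\<lambda>xs. ?V J n (\<psi> n) xs - ?E xs) +
          l2_norm (tuples X n) (\<lambda>xs. ?E xs - ?W n (\<psi> n) xs)"
          using V.tensor_shift_l2[OF l2] tensor_shift_l2[OF l2] level_embed_l2[OF tensor_shift_l2[OF l2]]
          unfolding n by (intro l2_norm_triangle_diff)
        \<comment> \<open>The full product is the case \<open>J = UNIV\<close> of
          \<open>near\<close>.\<close>
        also have "\<dots> \<le> e / 4 + e / 4"
          using near[where J = J and k = k] near[where J = UNIV and k = k] unfolding n
          by (simp only: tensor_shift_off[OF J(2)] tensor_shift_off[OF subset_UNIV]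
              l2_norm_minus_commute[where f = ?E])
        finally show ?thesis by simp
      qed
      then have "itp_dist X \<phi> (itp_partial_op X \<phi> (\<lambda>i. weighted_shift X (c i) (\<sigma> i)) J a) (?S a) \<le> e / 2"
        by (intro LIMSEQ_le_const2[OF lim]) blast
      moreover have "0 \<le> itp_dist X \<phi> (itp_partial_op X \<phi> (\<lambda>i. weighted_shift X (c i) (\<sigma> i)) J a) (?S a)"
        by (rule LIMSEQ_le_const[OF lim]) (simp add: l2_norm_nonneg)
      ultimately show ?thesis by simp
    qed
    then have "\<exists>F. finite F \<and> (\<forall>J. finite J \<and> F \<subseteq> J \<longrightarrow>
        dist (itp_dist X \<phi> (itp_partial_op X \<phi> (\<lambda>i. weighted_shift X (c i) (\<sigma> i)) J a) (?S a)) 0 < e)"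
      using \<open>e > 0\<close> by (intro exI[of _ "{..<N}"]) (force simp: dist_real_def)
    then show "\<forall>\<^sub>F J in finite_subsets_at_top UNIV.
        dist (itp_dist X \<phi> (itp_partial_op X \<phi> (\<lambda>i. weighted_shift X (c i) (\<sigma> i)) J a) (?S a)) 0 < e"
      by (simp add: eventually_finite_subsets_at_top)
  qed
  show ?thesis
    unfolding tensor_op_exists_def
    using itp_bounded_op_tensor_shift[OF summable] conv by blast
qed

section \<open>Almost invariant vectors\<close>

text \<open>The source of uniform convexity: a large \<open>f - g\<close> forces
  \<open>f + g\<close> to be shorter than the triangle inequality tells.\<close>

lemma l2_parallelogram:
  assumes "f \<in> l2 X" "g \<in> l2 X"
  shows "(l2_norm X (\<lambda>x. f x + g x))\<^sup>2 + (l2_norm X (\<lambda>x. f x - g x))\<^sup>2 =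
    2 * (l2_norm X f)\<^sup>2 + 2 * (l2_norm X g)\<^sup>2"
proof -
  have s: "(\<lambda>x. (cmod (f x))\<^sup>2) summable_on X" "(\<lambda>x. (cmod (g x))\<^sup>2) summable_on X"
    "(\<lambda>x. (cmod (f x + g x))\<^sup>2) summable_on X" "(\<lambda>x. (cmod (f x - g x))\<^sup>2) summable_on X"
    using assms l2_add[OF assms] l2_diff[OF assms] by (auto simp: l2_def)
  have "(\<Sum>\<^sub>\<infinity>x\<in>X. (cmod (f x + g x))\<^sup>2) + (\<Sum>\<^sub>\<infinity>x\<in>X. (cmod (f x - g x))\<^sup>2) =
    (\<Sum>\<^sub>\<infinity>x\<in>X. (cmod (f x + g x))\<^sup>2 + (cmod (f x - g x))\<^sup>2)"
    using s by (simp add: infsum_add)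
  also have "\<dots> = (\<Sum>\<^sub>\<infinity>x\<in>X. 2 * (cmod (f x))\<^sup>2 + 2 * (cmod (g x))\<^sup>2)"
    by (intro infsum_cong, simp only: cmod_power2) (simp add: power2_eq_square algebra_simps)
  also have "\<dots> = 2 * (\<Sum>\<^sub>\<infinity>x\<in>X. (cmod (f x))\<^sup>2) + 2 * (\<Sum>\<^sub>\<infinity>x\<in>X. (cmod (g x))\<^sup>2)"
    using s by (simp add: infsum_add infsum_cmult_right' summable_on_cmult_right)
  finally show ?thesis by (simp add: l2_norm_sq)
qed

lemma l2_sum:
  assumes "finite I" "\<And>i. i \<in> I \<Longrightarrow> f i \<in> l2 X"
  shows "(\<lambda>x. \<Sum>i\<in>I. f i x) \<in> l2 X"
  using assms by (induction I rule: finite_induct) (auto simp: l2_zero l2_add)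

lemma l2_norm_sum_le:
  assumes "finite I" "\<And>i. i \<in> I \<Longrightarrow> f i \<in> l2 X"
  shows "l2_norm X (\<lambda>x. \<Sum>i\<in>I. f i x) \<le> (\<Sum>i\<in>I. l2_norm X (f i))"
  using assms
proof (induction I rule: finite_induct)
  case (insert i I)
  then show ?case
    using l2_norm_triangle[of "f i" X "\<lambda>x. \<Sum>j\<in>I. f j x"] l2_sum[of I f X] by force
qed (simp add: l2_norm_zero)

lemma cmod_le_l2_norm: "f \<in> l2 X \<Longrightarrow> x \<in> X \<Longrightarrow> cmod (f x) \<le> l2_norm X f"
  using L2_set_le_l2_norm[of f X "{x}"] by (simp add: L2_set_def)

text \<open>For \<open>x\<close> in the group this is \<open>regular_rep\<close> of the trivial
  cocycle.\<close>

definition translate :: "('a, 'b) monoid_scheme \<Rightarrow> 'a \<Rightarrow> ('a \<Rightarrow> complex) \<Rightarrow> 'a \<Rightarrow> complex" where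
  "translate G x = weighted_shift (carrier G) (\<lambda>_. 1) (\<lambda>y. inv\<^bsub>G\<^esub> x \<otimes>\<^bsub>G\<^esub> y)"

section \<open>Translations on l2 of the group and positive superharmonic functions\<close>

context group
begin

lemma bij_betw_mult_left: "x \<in> carrier G \<Longrightarrow> bij_betw (\<lambda>y. inv x \<otimes> y) (carrier G) (carrier G)"
  by (rule bij_betw_byWitness[where f' = "\<lambda>y. x \<otimes> y"]) (auto simp flip: m_assoc)

lemma translate_l2: "x \<in> carrier G \<Longrightarrow> f \<in> l2 (carrier G) \<Longrightarrow> translate G x f \<in> l2 (carrier G)"
  unfolding translate_def by (intro weighted_shift_l2 bij_betw_mult_left) auto

lemma translate_norm: "x \<in> carrier G \<Longrightarrow> l2_norm (carrier G) (translate G x f) = l2_norm (carrier G) f"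
  unfolding translate_def by (intro weighted_shift_norm bij_betw_mult_left) auto

lemma translate_one: "f \<in> l2 (carrier G) \<Longrightarrow> translate G \<one> f = f"
  by (auto simp: translate_def weighted_shift_def l2_def)

text \<open>The logarithmic gradient of \<open>h\<close> along \<open>x\<close> is a bounded function whose mean changes sign when
  \<open>x\<close> is replaced by its inverse, so these means add up to 0 over a symmetric set; on the other hand
  \<open>ln t \<le> t - 1\<close> bounds the sum of the gradients by \<open>s - card F\<close>.\<close>

lemma card_le_superharmonic_factor:
  fixes h :: "'a \<Rightarrow> real" and s :: real
  assumes m: "invariant_mean G m"
    and F: "finite F" "F \<subseteq> carrier G" "\<And>x. x \<in> F \<Longrightarrow> inv x \<in> F"
    and h: "\<And>y. y \<in> carrier G \<Longrightarrow> 0 < h y"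
    and super: "\<And>y. y \<in> carrier G \<Longrightarrow> (\<Sum>x\<in>F. h (inv x \<otimes> y)) \<le> s * h y"
  shows "card F \<le> s"
proof -
  define b where "b f \<longleftrightarrow> bounded (f ` carrier G)" for f :: "'a \<Rightarrow> real"
  have bI: "b f" if "\<And>y. y \<in> carrier G \<Longrightarrow> \<bar>f y\<bar> \<le> B" for f B
    using that by (auto simp: b_def bounded_iff)
  have b_add: "b (\<lambda>y. f y + g y)" if "b f" "b g" for f g
    using that unfolding b_def by (rule bounded_plus_comp)
  have b_scale: "b (\<lambda>y. a * f y)" if "b f" for f a
    using that unfolding b_def by (auto simp: bounded_iff abs_mult) (meson abs_ge_zero mult_left_mono)
  have b_const: "b (\<lambda>y. a)" for a by (rule bI[where B = "\<bar>a\<bar>"]) simp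
  have b_sum: "b (\<lambda>y. \<Sum>x\<in>I. f x y)" if "finite I" "\<And>x. x \<in> I \<Longrightarrow> b (f x)" for I :: "'a set" and f
    using that by (induction I rule: finite_induct) (auto simp: b_const b_add)
  have m_add: "m (\<lambda>y. f y + g y) = m f + m g" if "b f" "b g" for f g
    using m that by (auto simp: invariant_mean_def b_def)
  have m_scale: "m (\<lambda>y. a * f y) = a * m f" if "b f" for f a
    using m that by (auto simp: invariant_mean_def b_def)
  have m_pos: "0 \<le> m f" if "b f" "\<And>y. y \<in> carrier G \<Longrightarrow> 0 \<le> f y" for f
    using m that by (auto simp: invariant_mean_def b_def)
  have m_const: "m (\<lambda>y. a) = a" for a
    using m_scale[OF b_const, of a 1] m by (simp add: invariant_mean_def)
  have m_shift: "m (\<lambda>y. f (inv x \<otimes> y)) = m f" if "b f" "x \<in> carrier G" for f x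
    using m that by (auto simp: invariant_mean_def b_def)
  have m_mono: "m f \<le> m g" if "b f" "b g" "\<And>y. y \<in> carrier G \<Longrightarrow> f y \<le> g y" for f g
  proof -
    have d: "b (\<lambda>y. g y + -1 * f y)" using that by (intro b_add b_scale)
    have "0 \<le> m (\<lambda>y. g y + -1 * f y)" using that by (intro m_pos d) simp
    also have "\<dots> = m g + m (\<lambda>y. -1 * f y)" using that by (intro m_add b_scale)
    also have "m (\<lambda>y. -1 * f y) = -1 * m f" using that by (intro m_scale)
    finally show ?thesis by simp
  qed
  have m_cong: "m f = m g" if "b f" "b g" "\<And>y. y \<in> carrier G \<Longrightarrow> f y = g y" for f g
    using m_mono[of f g] m_mono[of g f] that by force
  have m_sum: "m (\<lambda>y. \<Sum>x\<in>I. f x y) = (\<Sum>x\<in>I. m (f x))" if "finite I" "\<And>x. x \<in> I \<Longrightarrow> b (f x)"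
    for I :: "'a set" and f
    using that by (induction I rule: finite_induct) (auto simp: m_const m_add b_sum)
  \<comment> \<open>A Harnack inequality: one positive summand is at most the whole sum. Used for
    \<open>inv x\<close> too, it bounds the quotients of \<open>h\<close> in both directions, so the
    gradients are bounded and have a mean.\<close>
  have le: "h (inv x \<otimes> y) \<le> s * h y" if "x \<in> F" "y \<in> carrier G" for x y
  proof -
    have "h (inv x \<otimes> y) \<le> (\<Sum>x\<in>F. h (inv x \<otimes> y))"
      using that F by (intro member_le_sum less_imp_le[OF h]) auto
    then show ?thesis using super[OF that(2)] by simp
  qed
  have ge: "h y \<le> s * h (inv x \<otimes> y)" if "x \<in> F" "y \<in> carrier G" for x y
  proof -
    have x: "x \<in> carrier G" using that F by auto
    then have "inv (inv x) \<otimes> (inv x \<otimes> y) = y" using that by (simp flip: m_assoc)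
    then show ?thesis using le[OF F(3)[OF that(1)], of "inv x \<otimes> y"] x that by simp
  qed
  define g where "g x y = ln (h (inv x \<otimes> y) / h y)" for x y
  have bg: "b (g x)" if "x \<in> F" for x
  proof (rule bI)
    fix y assume y: "y \<in> carrier G"
    have p: "0 < h y" "0 < h (inv x \<otimes> y)" using h y that F by auto
    have s: "0 < s" using le[OF that y] p by (smt (verit) mult_nonpos_nonneg)
    have "h (inv x \<otimes> y) / h y \<le> s" "h y / h (inv x \<otimes> y) \<le> s"
      using le[OF that y] ge[OF that y] p by (auto simp: divide_simps)
    then have "ln (h (inv x \<otimes> y) / h y) \<le> ln s" "ln (h y / h (inv x \<otimes> y)) \<le> ln s"
      using p s by auto
    then show "\<bar>g x y\<bar> \<le> ln s" using p by (simp add: g_def ln_div)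
  qed
  have anti: "m (g (inv x)) = - m (g x)" if "x \<in> F" for x
  proof -
    have x: "x \<in> carrier G" using that F by auto
    have eq: "g (inv x) (inv x \<otimes> y) = -1 * g x y" if y: "y \<in> carrier G" for y
    proof -
      have "inv (inv x) \<otimes> (inv x \<otimes> y) = y" using x y by (simp flip: m_assoc)
      then show ?thesis using h[of y] h[of "inv x \<otimes> y"] x y by (simp add: g_def ln_div)
    qed
    have "b (\<lambda>y. g (inv x) (inv x \<otimes> y))"
      using b_scale[OF bg[OF that], of "-1"] eq unfolding b_def by (simp cong: image_cong_simp)
    then have "m (\<lambda>y. g (inv x) (inv x \<otimes> y)) = m (\<lambda>y. -1 * g x y)"
      by (intro m_cong b_scale bg that eq)
    then show ?thesis
      using m_shift[OF bg[OF F(3)[OF that]] x] m_scale[OF bg[OF that], of "-1"] by simp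
  qed
  \<comment> \<open>Inversion permutes \<open>F\<close>, so by \<open>anti\<close> the sum equals
    its own negative.\<close>
  have "(\<Sum>x\<in>F. m (g x)) = (\<Sum>x\<in>F. m (g (inv x)))"
  proof (rule sum.reindex_bij_witness[where i = "\<lambda>x. inv x" and j = "\<lambda>x. inv x"])
  qed (use F in auto)
  also have "\<dots> = - (\<Sum>x\<in>F. m (g x))" using anti by (simp add: sum_negf)
  finally have "0 = m (\<lambda>y. \<Sum>x\<in>F. g x y)" using m_sum[OF F(1) bg] by simp
  also have "\<dots> \<le> m (\<lambda>y. s - card F)"
  proof (rule m_mono)
    show "b (\<lambda>y. \<Sum>x\<in>F. g x y)" using F bg by (intro b_sum)
    fix y assume y: "y \<in> carrier G"
    have "(\<Sum>x\<in>F. g x y) \<le> (\<Sum>x\<in>F. h (inv x \<otimes> y) / h y - 1)"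
      unfolding g_def using h y F by (intro sum_mono ln_le_minus_one divide_pos_pos) auto
    also have "\<dots> = (\<Sum>x\<in>F. h (inv x \<otimes> y)) / h y - card F"
      by (simp add: sum_subtractf sum_divide_distrib)
    also have "\<dots> \<le> s - card F"
      using super[OF y] h[OF y] by (simp add: divide_le_eq)
    finally show "(\<Sum>x\<in>F. g x y) \<le> s - card F" .
  qed (rule b_const)
  finally show ?thesis by (simp add: m_const)
qed

text \<open>With \<open>P\<close> the sum of the translations by \<open>F\<close>, the function \<open>h = \<Sum>\<^sub>n P\<^sup>n w / s\<^sup>n\<close> satisfies
  \<open>P h = s (h - w)\<close>.\<close>

lemma superharmonic_exists:
  assumes C: "countable (carrier G)"
    and F: "finite F" "F \<subseteq> carrier G"
    and q: "0 \<le> q" "q < s"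
    and contr: "\<And>f. f \<in> l2 (carrier G) \<Longrightarrow>
      l2_norm (carrier G) (\<lambda>y. \<Sum>x\<in>F. translate G x f y) \<le> q * l2_norm (carrier G) f"
  obtains h :: "'a \<Rightarrow> real" where "\<And>y. y \<in> carrier G \<Longrightarrow> 0 < h y"
    "\<And>y. y \<in> carrier G \<Longrightarrow> (\<Sum>x\<in>F. h (inv x \<otimes> y)) \<le> s * h y"
proof -
  let ?X = "carrier G"
  \<comment> \<open>Enumerating the countable group makes \<open>w\<close> strictly positive on it,
    with squares among the terms of the geometric series of ratio 1/4.\<close>
  define w :: "'a \<Rightarrow> real" where "w y = (if y \<in> ?X then (1/2) ^ to_nat_on ?X y else 0)" for y
  define P :: "('a \<Rightarrow> real) \<Rightarrow> 'a \<Rightarrow> real" where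
    "P f y = (if y \<in> ?X then \<Sum>x\<in>F. f (inv x \<otimes> y) else 0)" for f y
  define a where "a n = (P ^^ n) w" for n
  have a_Suc: "a (Suc n) y = (\<Sum>x\<in>F. a n (inv x \<otimes> y))" if "y \<in> ?X" for n y
    using that by (simp add: a_def P_def)
  have a_nonneg: "0 \<le> a n y" for n y
  proof (induction n arbitrary: y)
    case (Suc n)
    then show ?case by (auto simp: a_def P_def intro: sum_nonneg)
  qed (simp add: a_def w_def)
  have "(\<lambda>n. (1/4 :: real) ^ n) summable_on to_nat_on ?X ` ?X"
    using summable_on_UNIV_nonneg_real_iff[of "\<lambda>n. (1/4 :: real) ^ n"]
    by (auto intro: summable_on_subset_banach[of _ UNIV] summable_geometric)
  then have "(\<lambda>y. (1/4 :: real) ^ to_nat_on ?X y) summable_on ?X"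
    using summable_on_reindex[OF inj_on_to_nat_on[OF C], of "\<lambda>n. (1/4 :: real) ^ n"] by (simp add: o_def)
  then have "(\<lambda>y. (cmod (of_real (w y)))\<^sup>2) summable_on ?X"
    by (rule summable_on_cong[THEN iffD1, rotated]) (simp add: w_def norm_power norm_divide power2_eq_square flip: power_mult_distrib)
  then have w2: "(\<lambda>y. complex_of_real (w y)) \<in> l2 ?X"
    by (auto simp: l2_def w_def)
  define W where "W = l2_norm ?X (\<lambda>y. complex_of_real (w y))"
  have l2: "(\<lambda>y. complex_of_real (a n y)) \<in> l2 ?X \<and>
      l2_norm ?X (\<lambda>y. complex_of_real (a n y)) \<le> q ^ n * W" for n
  proof (induction n)
    case 0
    then show ?case using w2 by (simp add: a_def W_def)
  next
    case (Suc n)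
    let ?f = "\<lambda>y. complex_of_real (a n y)"
    have eq: "(\<lambda>y. complex_of_real (a (Suc n) y)) = (\<lambda>y. \<Sum>x\<in>F. translate G x ?f y)"
      by (auto simp: a_def P_def translate_def weighted_shift_def)
    have "l2_norm ?X (\<lambda>y. \<Sum>x\<in>F. translate G x ?f y) \<le> q * (q ^ n * W)"
      using contr[of ?f] Suc q by (meson mult_left_mono order_trans)
    moreover have "(\<lambda>y. \<Sum>x\<in>F. translate G x ?f y) \<in> l2 ?X"
      using F Suc by (intro l2_sum translate_l2) auto
    ultimately show ?case unfolding eq by simp
  qed
  \<comment> \<open>A value is at most the l2 norm, hence at most \<open>q ^ n * W\<close> by the
    contraction; division by \<open>s ^ n\<close> leaves a geometric series of ratio
    \<open>q / s < 1\<close>.\<close>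
  have sumble: "summable (\<lambda>n. a n y / s ^ n)" if "y \<in> ?X" for y
  proof (rule summable_comparison_test')
    show "summable (\<lambda>n. W * (q / s) ^ n)"
      using q by (intro summable_mult summable_geometric) auto
    fix n :: nat
    have "a n y \<le> q ^ n * W"
      using cmod_le_l2_norm[OF conjunct1[OF l2[of n]] that] l2[of n] a_nonneg[of n y] by simp
    then have "a n y / s ^ n \<le> q ^ n * W / s ^ n"
      using q by (intro divide_right_mono) auto
    then show "norm (a n y / s ^ n) \<le> W * (q / s) ^ n"
      using a_nonneg[of n y] q by (simp add: power_divide mult.commute)
  qed
  define h where "h y = (\<Sum>n. a n y / s ^ n)" for y
  have s: "0 < s" using q by simp
  \<comment> \<open>The term at \<open>n = 0\<close> is \<open>w\<close>, and the others are
    nonnegative, whence \<open>h\<close> is at least \<open>w\<close> and thus positive.\<close>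
  have split: "(\<Sum>n. a (Suc n) y / s ^ Suc n) = h y - w y" if "y \<in> ?X" for y
    using suminf_split_head[OF sumble[OF that]] by (simp add: h_def a_def)
  have wpos: "0 < w y" if "y \<in> ?X" for y using that by (simp add: w_def)
  show ?thesis
  proof
    fix y assume y: "y \<in> ?X"
    have "0 \<le> (\<Sum>n. a (Suc n) y / s ^ Suc n)"
      using sumble[OF y] s a_nonneg by (intro suminf_nonneg) (auto simp: summable_Suc_iff[of "\<lambda>n. a n y / s ^ n"] simp del: power_Suc)
    then show "0 < h y" using split[OF y] wpos[OF y] by linarith
    \<comment> \<open>\<open>P\<close> turns \<open>a n\<close> into \<open>a (Suc n)\<close>: the
      series moves by one index and gains a factor \<open>s\<close>.\<close>
    have "(\<Sum>x\<in>F. h (inv x \<otimes> y)) = (\<Sum>n. \<Sum>x\<in>F. a n (inv x \<otimes> y) / s ^ n)"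
      unfolding h_def using y F by (intro suminf_sum[symmetric] sumble) auto
    also have "\<dots> = (\<Sum>n. s * (a (Suc n) y / s ^ Suc n))"
      using s y by (intro suminf_cong) (simp add: a_Suc flip: sum_divide_distrib)
    also have "\<dots> = s * (h y - w y)"
      using sumble[OF y] split[OF y] summable_Suc_iff[of "\<lambda>n. a n y / s ^ n"] by (subst suminf_mult) auto
    also have "\<dots> \<le> s * h y" using s wpos[OF y] by simp
    finally show "(\<Sum>x\<in>F. h (inv x \<otimes> y)) \<le> s * h y" .
  qed
qed

text \<open>Some \<open>x\<close> in \<open>F\<close> moves the normalized \<open>f\<close> by at
  least \<open>e\<close>. By the parallelogram law the translates by \<open>x\<close> and
  \<open>\<one>\<close> together have norm at most \<open>sqrt (4 - e\<^sup>2)\<close> times that of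
  \<open>f\<close>; the triangle inequality handles the other \<open>card F - 2\<close>.\<close>

lemma sum_translate_contraction:
  assumes F: "finite F" "F \<subseteq> carrier G" "\<one> \<in> F"
    and e: "0 < e"
    and far: "\<And>\<xi>. \<xi> \<in> l2 (carrier G) \<Longrightarrow> l2_norm (carrier G) \<xi> = 1 \<Longrightarrow>
      \<exists>x\<in>F. e \<le> l2_norm (carrier G) (\<lambda>y. translate G x \<xi> y - \<xi> y)"
    and f: "f \<in> l2 (carrier G)"
  shows "l2_norm (carrier G) (\<lambda>y. \<Sum>x\<in>F. translate G x f y) \<le>
    (real (card F) - 2 + sqrt (4 - e\<^sup>2)) * l2_norm (carrier G) f"
proof (cases "l2_norm (carrier G) f = 0")
  case True
  have "l2_norm (carrier G) (\<lambda>y. \<Sum>x\<in>F. translate G x f y) \<le> (\<Sum>x\<in>F. l2_norm (carrier G) (translate G x f))"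
    using F f by (intro l2_norm_sum_le translate_l2) auto
  also have "\<dots> = 0" using F True by (intro sum.neutral) (auto simp: translate_norm)
  finally show ?thesis using True by simp
next
  case False
  let ?X = "carrier G" and ?c = "complex_of_real (1 / l2_norm (carrier G) f)"
  let ?r = "l2_norm ?X f"
  have r: "0 < ?r" using False l2_norm_nonneg[of ?X f] by simp
  have "l2_norm ?X (\<lambda>y. ?c * f y) = 1" using r by (simp only: l2_norm_scale) (simp add: norm_divide)
  then obtain x where x: "x \<in> F" and d: "e \<le> l2_norm ?X (\<lambda>y. translate G x (\<lambda>y. ?c * f y) y - ?c * f y)"
    using far[OF l2_scale[OF f]] by blast
  have "(\<lambda>y. translate G x (\<lambda>y. ?c * f y) y - ?c * f y) = (\<lambda>y. ?c * (translate G x f y - f y))"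
    by (simp only: translate_def weighted_shift_scale right_diff_distrib)
  then have "e \<le> cmod ?c * l2_norm ?X (\<lambda>y. translate G x f y - f y)"
    using d by (simp only: l2_norm_scale)
  then have d: "e * ?r \<le> l2_norm ?X (\<lambda>y. translate G x f y - f y)"
    using r by (simp add: norm_divide divide_simps)
  \<comment> \<open>The identity moves nothing, so \<open>x\<close> and \<open>\<one>\<close> are
    two different summands to split off.\<close>
  have x1: "x \<noteq> \<one>"
    using d e r by (auto simp: translate_one[OF f] l2_norm_zero mult_le_0_iff)
  have xG: "x \<in> ?X" using x F by auto
  have tf: "translate G x f \<in> l2 ?X" by (rule translate_l2[OF xG f])
  have "(e * ?r)\<^sup>2 \<le> (l2_norm ?X (\<lambda>y. translate G x f y - f y))\<^sup>2"
    using d e r by (intro power_mono) auto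
  then have "(l2_norm ?X (\<lambda>y. translate G x f y + f y))\<^sup>2 \<le> (4 - e\<^sup>2) * ?r\<^sup>2"
    using l2_parallelogram[OF tf f] by (simp add: translate_norm[OF xG] power_mult_distrib algebra_simps)
  then have "l2_norm ?X (\<lambda>y. translate G x f y + f y) \<le> sqrt ((4 - e\<^sup>2) * ?r\<^sup>2)"
    by (rule real_le_rsqrt)
  then have two: "l2_norm ?X (\<lambda>y. translate G x f y + f y) \<le> sqrt (4 - e\<^sup>2) * ?r"
    using r by (simp add: real_sqrt_mult)
  let ?F = "F - {x} - {\<one>}"
  have card: "real (card ?F) = real (card F) - 2"
  proof -
    have "card {x, \<one>} \<le> card F" using x F by (intro card_mono) auto
    then show ?thesis using x x1 F by (simp add: card_Diff_singleton of_nat_diff)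
  qed
  have "(\<lambda>y. \<Sum>z\<in>F. translate G z f y) =
      (\<lambda>y. (translate G x f y + f y) + (\<Sum>z\<in>?F. translate G z f y))"
    using F x x1 by (simp add: sum.remove[of F x] sum.remove[of "F - {x}" \<one>] translate_one[OF f] add.assoc)
  then have "l2_norm ?X (\<lambda>y. \<Sum>z\<in>F. translate G z f y) \<le>
      l2_norm ?X (\<lambda>y. translate G x f y + f y) + l2_norm ?X (\<lambda>y. \<Sum>z\<in>?F. translate G z f y)"
    using l2_norm_triangle[OF l2_add[OF tf f] l2_sum[of ?F "\<lambda>z. translate G z f"]] F
      translate_l2[OF _ f] by auto
  also have "l2_norm ?X (\<lambda>y. \<Sum>z\<in>?F. translate G z f y) \<le> (\<Sum>z\<in>?F. l2_norm ?X (translate G z f))"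
    using F f by (intro l2_norm_sum_le translate_l2) auto
  also have "\<dots> = (\<Sum>z\<in>?F. ?r)" using F by (intro sum.cong) (auto simp: translate_norm)
  also have "\<dots> = (real (card F) - 2) * ?r" by (simp only: sum_constant card)
  finally show ?thesis using two by (simp add: algebra_simps)
qed

theorem amenable_almost_invariant_vector:
  assumes "countable (carrier G)" "amenable G" "finite F" "F \<subseteq> carrier G" "0 < e"
  shows "\<exists>\<xi>\<in>l2 (carrier G). l2_norm (carrier G) \<xi> = 1 \<and>
    (\<forall>x\<in>F. l2_norm (carrier G) (\<lambda>y. translate G x \<xi> y - \<xi> y) < e)"
proof (rule ccontr)
  assume *: "\<not> ?thesis"
  obtain m where m: "invariant_mean G m" using assms by (auto simp: amenable_def)
  \<comment> \<open>The identity serves the contraction estimate, the inverses serve the symmetry in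
    \<open>card_le_superharmonic_factor\<close>.\<close>
  let ?F = "insert \<one> (F \<union> m_inv G ` F)"
  let ?q = "real (card ?F) - 2 + sqrt (4 - e\<^sup>2)"
  \<comment> \<open>\<open>?q\<close> may be negative, while \<open>superharmonic_exists\<close>
    asks for a nonnegative bound.\<close>
  define q where "q = max 0 ?q"
  have F: "finite ?F" "?F \<subseteq> carrier G" "\<one> \<in> ?F" using assms by auto
  have "sqrt (4 - e\<^sup>2) < sqrt (2\<^sup>2)" using assms by (intro real_sqrt_less_mono) simp
  moreover have "card ?F > 0" using F(1) by (simp add: card_gt_0_iff)
  ultimately have "q < card ?F" by (simp add: q_def)
  then obtain s where s: "q < s" "s < card ?F" using dense by blast
  have contr: "l2_norm (carrier G) (\<lambda>y. \<Sum>x\<in>?F. translate G x f y) \<le> q * l2_norm (carrier G) f"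
    if "f \<in> l2 (carrier G)" for f
  proof -
    \<comment> \<open>A unit vector moved by less than \<open>e\<close> by all of \<open>?F\<close>
      would be one for \<open>F\<close>, against \<open>*\<close>.\<close>
    have "l2_norm (carrier G) (\<lambda>y. \<Sum>x\<in>?F. translate G x f y) \<le> ?q * l2_norm (carrier G) f"
      using * by (intro sum_translate_contraction[OF F assms(5) _ that]) force
    also have "\<dots> \<le> q * l2_norm (carrier G) f"
      by (intro mult_right_mono) (auto simp: q_def l2_norm_nonneg)
    finally show ?thesis .
  qed
  obtain h :: "'a \<Rightarrow> real" where h: "\<And>y. y \<in> carrier G \<Longrightarrow> 0 < h y"
    "\<And>y. y \<in> carrier G \<Longrightarrow> (\<Sum>x\<in>?F. h (inv x \<otimes> y)) \<le> s * h y"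
    by (rule superharmonic_exists[OF assms(1) F(1,2) _ s(1) contr]) (auto simp: q_def)
  have "inv x \<in> ?F" if "x \<in> ?F" for x
    using that assms(4) by auto
  from card_le_superharmonic_factor[OF m F(1,2) this h] have "card ?F \<le> s" .
  then show False using s by simp
qed

end

section \<open>Factoring a cocycle\<close>

lemma cmod_cis_minus_one_le: "cmod (cis t - 1) \<le> \<bar>t\<bar>"
  using dist_exp_i_1[of t] abs_sin_x_le_abs_x[of "t / 2"] by (simp add: cis_conv_exp)

lemma prod_cis: "(\<Prod>i\<in>J. cis (f i)) = cis (\<Sum>i\<in>J. f i)"
  by (induction J rule: infinite_finite_induct) (auto simp: cis_mult)

lemma cis_neq_one: "0 < t \<Longrightarrow> t < 2 \<Longrightarrow> cis t \<noteq> 1"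
  using sin_gt_zero_02[of t] by (auto simp: complex_eq_iff)

lemma l2_norm_mono:
  assumes "f \<in> l2 X" "g \<in> l2 X" "\<And>x. x \<in> X \<Longrightarrow> cmod (f x) \<le> cmod (g x)"
  shows "l2_norm X f \<le> l2_norm X g"
  unfolding l2_norm_def using assms
  by (intro real_sqrt_le_mono infsum_mono power_mono) (auto simp: l2_def)

lemma Z2_unimodular:
  "u \<in> carrier (Z2 G) \<Longrightarrow> x \<in> carrier G \<Longrightarrow> y \<in> carrier G \<Longrightarrow> cmod (u (x, y)) = 1"
  using PiE_mem[of u "carrier G \<times> carrier G" "\<lambda>_. sphere 0 1" "(x, y)"]
  by (auto simp: Z2_def cocycles_def)

text \<open>Term 0 cancels the total \<open>c\<close> of the later terms \<open>c/2\<close>,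
  \<open>c/4\<close>, and so on, while the size of term \<open>i\<close> is
  \<open>c * (1/2) ^ i\<close> for every \<open>i\<close>.\<close>

definition phase_sequence :: "real \<Rightarrow> nat \<Rightarrow> real" where
  "phase_sequence c i = (if i = 0 then - c else c * (1/2) ^ i)"

lemma abs_phase_sequence: "0 \<le> c \<Longrightarrow> \<bar>phase_sequence c i\<bar> = c * (1/2) ^ i"
  by (simp add: phase_sequence_def abs_mult)

lemma phase_sequence_has_sum: "0 \<le> c \<Longrightarrow> (phase_sequence c has_sum 0) UNIV"
proof (rule norm_summable_imp_has_sum)
  assume c: "0 \<le> c"
  then show "summable (\<lambda>n. norm (phase_sequence c n))"
    by (simp add: abs_phase_sequence summable_geometric)
  \<comment> \<open>The full geometric series has sum \<open>2 * c\<close>; subtracting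
    \<open>2 * c\<close> at index 0 turns \<open>c\<close> into \<open>- c\<close> there.\<close>
  have "(\<lambda>i. c * (1/2) ^ i - (if i = 0 then 2 * c else 0)) sums (c * (1 / (1 - 1/2)) - 2 * c)"
    by (intro sums_diff sums_mult geometric_sums sums_single[of 0 "\<lambda>_. 2 * c"]) simp
  moreover have "(\<lambda>i. c * (1/2) ^ i - (if i = 0 then 2 * c else 0)) = phase_sequence c"
    by (auto simp: phase_sequence_def)
  ultimately show "phase_sequence c sums 0" by simp
qed

text \<open>Once \<open>J\<close> contains 0, the finite product is \<open>z * cis\<close> of
  \<open>k\<close> times the partial sum of the phases; continuity of \<open>cis\<close> carries
  over the unconditional convergence of these sums to 0.\<close>

lemma prod_cis_phase_sequence:
  assumes "0 \<le> c"
  shows "has_net_prod (\<lambda>i. (if i = 0 then z else 1) * cis (phase_sequence c i * k)) z"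
proof -
  have "((\<lambda>J. \<Sum>i\<in>J. phase_sequence c i) \<longlongrightarrow> 0) (finite_subsets_at_top UNIV)"
    using phase_sequence_has_sum[OF assms] by (simp add: has_sum_def)
  then have "((\<lambda>J. z * cis ((\<Sum>i\<in>J. phase_sequence c i) * k)) \<longlongrightarrow> z * cis (0 * k)) (finite_subsets_at_top UNIV)"
    by (intro tendsto_intros)
  moreover have "\<forall>\<^sub>F J in finite_subsets_at_top UNIV. z * cis ((\<Sum>i\<in>J. phase_sequence c i) * k) =
      (\<Prod>i\<in>J. (if i = 0 then z else 1) * cis (phase_sequence c i * k))"
    unfolding eventually_finite_subsets_at_top
    by (intro exI[of _ "{0}"])
      (auto simp: prod.distrib prod_cis sum_distrib_right prod.delta)
  ultimately show ?thesis
    unfolding has_net_prod_def by (simp add: tendsto_cong)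
qed

lemma (in group) cocycle_product_tensor:
  assumes nontrivial: "carrier G \<noteq> {\<one>}" and C: "countable (carrier G)" and "amenable G"
    and v: "v \<in> carrier (Z2 G)"
  shows "\<exists>u \<phi>. product_sequence G u \<and> (\<forall>i. u i \<noteq> \<one>\<^bsub>Z2 G\<^esub>) \<and>
    (\<forall>i. \<phi> i \<in> l2 (carrier G) \<and> l2_norm (carrier G) (\<phi> i) = 1) \<and>
    (\<forall>x\<in>carrier G. tensor_op_exists (carrier G) \<phi> (\<lambda>i. regular_rep G (u i) x)) \<and>
    is_product_of G v u"
proof -
  interpret Z: comm_group "Z2 G" by (rule comm_group_Z2) unfold_locales
  let ?X = "carrier G"
  obtain g where g: "g \<in> ?X" "g \<noteq> \<one>" using nontrivial by auto
  \<comment> \<open>The additive coboundary of the indicator function of \<open>g\<close>: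
    \<open>cis (t * k x y)\<close> is the coboundary of
    \<open>cis (t * of_bool (x = g))\<close>.\<close>
  define k :: "'a \<Rightarrow> 'a \<Rightarrow> real" where "k x y = of_bool (x = g) + of_bool (y = g) - of_bool (x \<otimes> y = g)" for x y
  have k_le: "\<bar>k x y\<bar> \<le> 2" for x y by (simp add: k_def)
  \<comment> \<open>As \<open>g\<close> is not the identity, \<open>g \<otimes> g\<close> differs
    from \<open>g\<close>.\<close>
  have kgg: "k g g = 2" using g by (simp add: k_def)
  \<comment> \<open>At \<open>(g, g)\<close> the factor \<open>u 0\<close> will have the value
    \<open>v (g, g) * cis (- (2 * c))\<close>. The choices 1/2 and 1/4 cannot both make this 1,
    since \<open>cis (- 1)\<close> and \<open>cis (- 1/2)\<close> differ.\<close>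
  have "\<exists>c. 0 < c \<and> c < 1 \<and> v (g, g) * cis (- (2 * c)) \<noteq> 1"
  proof (rule ccontr)
    assume n: "\<not> ?thesis"
    have "v (g, g) * cis (- (2 * (1/2))) = 1" "v (g, g) * cis (- (2 * (1/4))) = 1"
      using n[unfolded not_ex, rule_format, of "1/2"] n[unfolded not_ex, rule_format, of "1/4"] by auto
    then have "cis (- (2 * (1/2))) = cis (- (2 * (1/4)))"
      by (metis mult_cancel_left mult_zero_left zero_neq_one)
    then have "cis 1 * cis (- (2 * (1/2))) = cis 1 * cis (- (2 * (1/4)))" by simp
    then show False using cis_neq_one[of "1/2"] by (simp add: cis_mult)
  qed
  then obtain c where c: "0 < c" "c < 1" "v (g, g) * cis (- (2 * c)) \<noteq> 1" by blast
  let ?\<theta> = "phase_sequence c"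
  define \<rho> where "\<rho> i x = cis (?\<theta> i * of_bool (x = g))" for i x
  define u where "u i = (if i = 0 then v else \<one>\<^bsub>Z2 G\<^esub>) \<otimes>\<^bsub>Z2 G\<^esub> coboundary G (\<rho> i)" for i
  have u_Z2: "u i \<in> carrier (Z2 G)" for i
    using g v unfolding u_def
    by (intro Z.m_closed coboundary_cocycle) (auto simp: \<rho>_def is_group)
  have u_eq: "u i (x, y) = (if i = 0 then v (x, y) else 1) * cis (?\<theta> i * k x y)"
    if "x \<in> ?X" "y \<in> ?X" for i x y
    using that by (auto simp: u_def Z2_def coboundary_def \<rho>_def k_def cis_mult cis_cnj algebra_simps)
  have u_gg: "u i (g, g) \<noteq> 1" for i
  proof (cases "i = 0")
    case True
    then show ?thesis using c g by (simp add: u_eq kgg phase_sequence_def mult.commute)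
  next
    case False
    \<comment> \<open>The phase of \<open>u i\<close> at \<open>(g, g)\<close> lies strictly between
      0 and 2, where \<open>cis\<close> is not 1.\<close>
    have "c * (1/2) ^ i * 2 < 2" "0 < c * (1/2) ^ i * 2"
      using c power_le_one[of "1/2 :: real" i] mult_strict_mono[of c 1 "(1/2) ^ i" 1]
      by (auto intro: le_less_trans[OF mult_left_le])
    then show ?thesis using False g by (simp add: u_eq kgg phase_sequence_def cis_neq_one)
  qed
  have "u i \<noteq> \<one>\<^bsub>Z2 G\<^esub>" for i
    using u_gg[of i] g by (auto simp: Z2_def)
  moreover have prod: "has_net_prod (\<lambda>i. u i (x, y)) (v (x, y))" if "x \<in> ?X" "y \<in> ?X" for x y
    using prod_cis_phase_sequence[of c "v (x, y)" "k x y"] c that by (simp add: u_eq)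
  moreover have "product_sequence G u"
    using u_Z2 prod unfolding product_sequence_def by blast
  moreover have "is_product_of G v u"
    using prod unfolding is_product_of_def by blast
  moreover have "\<exists>\<phi>. (\<forall>i. \<phi> i \<in> l2 ?X \<and> l2_norm ?X (\<phi> i) = 1) \<and>
    (\<forall>x\<in>?X. tensor_op_exists ?X \<phi> (\<lambda>i. regular_rep G (u i) x))"
  proof -
    \<comment> \<open>These finite sets increase and exhaust the group, so one sequence of vectors
      serves every \<open>x\<close>.\<close>
    let ?F = "\<lambda>i. from_nat_into ?X ` {..i :: nat}"
    have ne: "?X \<noteq> {}" using g by auto
    have "\<exists>\<xi>\<in>l2 ?X. l2_norm ?X \<xi> = 1 \<and>
        (\<forall>x\<in>?F i. l2_norm ?X (\<lambda>y. translate G x \<xi> y - \<xi> y) < (1/2) ^ i)" for i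
      using C \<open>amenable G\<close> from_nat_into[OF ne] by (intro amenable_almost_invariant_vector) auto
    then obtain \<phi> where \<phi>: "\<And>i. \<phi> i \<in> l2 ?X" "\<And>i. l2_norm ?X (\<phi> i) = 1"
      and near: "\<And>i x. x \<in> ?F i \<Longrightarrow> l2_norm ?X (\<lambda>y. translate G x (\<phi> i) y - \<phi> i y) < (1/2) ^ i"
      by metis
    have "tensor_op_exists ?X \<phi> (\<lambda>i. regular_rep G (u i) x)" if x: "x \<in> ?X" for x
    proof -
      interpret shift_family ?X \<phi> "\<lambda>i y. u i (inv y, x)" "\<lambda>i y. inv x \<otimes> y"
        using \<phi> x u_Z2 by unfold_locales (auto intro: bij_betw_mult_left Z2_unimodular)
      let ?T = "\<lambda>i. weighted_shift ?X (\<lambda>y. u i (inv y, x)) (\<lambda>y. inv x \<otimes> y)"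
      have T: "regular_rep G (u i) x = ?T i" for i
        by (intro ext) (simp add: regular_rep_def weighted_shift_def)
      have Tl2: "?T i (\<phi> i) \<in> l2 ?X" for i
        by (intro weighted_shift_l2 bij unimodular \<phi>)
      obtain j where j: "from_nat_into ?X j = x" using from_nat_into_surj[OF C x] by blast
      \<comment> \<open>The part \<open>2 * c\<close> pays for replacing \<open>u i\<close> by the
        trivial cocycle, the part 1 for the almost invariance of \<open>\<phi> i\<close>.\<close>
      have "\<forall>\<^sub>F i in sequentially. norm (l2_norm ?X (\<lambda>y. ?T i (\<phi> i) y - \<phi> i y)) \<le> (2 * c + 1) * (1/2) ^ i"
      proof (intro eventually_sequentiallyI)
        \<comment> \<open>Then \<open>i > 0\<close>, so \<open>u i\<close> lacks the factor
          \<open>v\<close>, and \<open>i \<ge> j\<close>, so \<open>x\<close> is in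
          \<open>?F i\<close>.\<close>
        fix i assume i: "Suc j \<le> i"
        let ?S = "translate G x (\<phi> i)"
        have S: "?S \<in> l2 ?X" by (rule translate_l2[OF x \<phi>(1)])
        have "l2_norm ?X (\<lambda>y. ?T i (\<phi> i) y - ?S y) \<le> l2_norm ?X (\<lambda>y. of_real (2 * c * (1/2) ^ i) * ?S y)"
        proof (rule l2_norm_mono)
          fix y assume y: "y \<in> ?X"
          have "cmod (?T i (\<phi> i) y - ?S y) = cmod (cis (?\<theta> i * k (inv y) x) - 1) * cmod (?S y)"
            using i y x by (simp add: weighted_shift_def translate_def u_eq left_diff_distrib flip: norm_mult)
          also have "\<dots> \<le> \<bar>?\<theta> i * k (inv y) x\<bar> * cmod (?S y)"
            by (intro mult_right_mono cmod_cis_minus_one_le) auto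
          also have "\<dots> \<le> (c * (1/2) ^ i * 2) * cmod (?S y)"
            using c k_le[of "inv y" x]
            by (intro mult_right_mono) (auto simp: abs_mult abs_phase_sequence intro!: mult_left_mono)
          finally show "cmod (?T i (\<phi> i) y - ?S y) \<le> cmod (of_real (2 * c * (1/2) ^ i) * ?S y)"
            using c by (simp add: norm_mult norm_power norm_divide mult_ac)
        qed (use Tl2 S in \<open>auto intro: l2_diff l2_scale\<close>)
        also have "\<dots> = 2 * c * (1/2) ^ i"
          using c by (simp only: l2_norm_scale translate_norm[OF x] \<phi>) (simp add: norm_mult norm_power norm_divide)
        finally have "l2_norm ?X (\<lambda>y. ?T i (\<phi> i) y - ?S y) \<le> 2 * c * (1/2) ^ i" .
        moreover have "l2_norm ?X (\<lambda>y. ?S y - \<phi> i y) \<le> (1/2) ^ i"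
          using j i by (intro less_imp_le near) auto
        ultimately show "norm (l2_norm ?X (\<lambda>y. ?T i (\<phi> i) y - \<phi> i y)) \<le> (2 * c + 1) * (1/2) ^ i"
          using l2_norm_triangle_diff[OF Tl2 S \<phi>(1), of i i] by (simp add: l2_norm_nonneg distrib_right)
      qed
      then have "summable (\<lambda>i. l2_norm ?X (\<lambda>y. ?T i (\<phi> i) y - \<phi> i y))"
        by (rule summable_comparison_test_ev) (intro summable_mult summable_geometric, simp)
      then show ?thesis unfolding T by (rule tensor_op_exists_weighted_shift)
    qed
    then show ?thesis using \<phi> by blast
  qed
  ultimately show ?thesis by blast
qed

theorem corollary3p5:
  fixes G :: "('a, 'b) monoid_scheme"
  assumes "group G"
    and "carrier G \<noteq> {\<one>\<^bsub>G\<^esub>}"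
    and "countable (carrier G)"
    and "amenable G"
  shows "(\<exists>u \<phi>.
            product_sequence G u \<and>
            (\<forall>i. u i \<noteq> \<one>\<^bsub>Z2 G\<^esub>) \<and>
            (\<forall>i. \<phi> i \<in> l2 (carrier G) \<and> l2_norm (carrier G) (\<phi> i) = 1) \<and>
            (\<forall>x\<in>carrier G. tensor_op_exists (carrier G) \<phi> (\<lambda>i. regular_rep G (u i) x))) \<and>
         (carrier (H2 G) \<noteq> {\<one>\<^bsub>H2 G\<^esub>} \<longrightarrow>
          (\<forall>v\<in>carrier (Z2 G). cohomology_class G v \<noteq> \<one>\<^bsub>H2 G\<^esub> \<longrightarrow>
            (\<exists>u \<phi>.
               product_sequence G u \<and>
               (\<forall>i. u i \<noteq> \<one>\<^bsub>Z2 G\<^esub>) \<and>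
               (\<forall>i. \<phi> i \<in> l2 (carrier G) \<and> l2_norm (carrier G) (\<phi> i) = 1) \<and>
               (\<forall>x\<in>carrier G. tensor_op_exists (carrier G) \<phi> (\<lambda>i. regular_rep G (u i) x)) \<and>
               is_product_of G v u)))"
proof -
  interpret group G by fact
  interpret Z: comm_group "Z2 G" by (rule comm_group_Z2) fact
  \<comment> \<open>The first claim is the case of the trivial cocycle as the product.\<close>
  show ?thesis
    using cocycle_product_tensor[OF assms(2,3,4) Z.one_closed] cocycle_product_tensor[OF assms(2,3,4)]
    by blast
qed

end
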